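(* For odd $n\ge 3$, the diameter of the graph $\mathcal{H}_n$ is at least $n-1$ and at most $11n-29$.
   Context: Fix an integer $n\ge 2$ and place $2n$ points equidistantly on the unit circle. $\mathcal{M}_n$ is the set of all non-crossing straight-line perfect matchings on these $2n$ points (each has $n$ edges). For $M\in\mathcal{M}_n$, two edges $e,f\in M$ span an empty quadrilateral if the convex hull of $e$ and $f$ contains no other edge of $M$; replacing $e,f$ by the other two edges of this quadrilateral yields another matching of $\mathcal{M}_n$ (a flip). A flip is centered if the closed quadrilateral contains the center of the circle (possibly on its boundary). $\mathcal{H}_n$ is the graph with vertex set $\mathcal{M}_n$ and an edge between two matchings if they differ by a centered flip. *)

theory Defs
  imports "HOL-Analysis.Analysis" "Graph_Theory.Shortest_Path"
begin

definition circle_points :: "nat \<Rightarrow> complex set" where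
  "circle_points n = (\<lambda>k. cis (2 * pi * real k / real (2 * n))) ` {..<2 * n}"

text \<open>An edge is represented by the set of its two end points; the corresponding straight-line
  segment is its convex hull.\<close>

definition nc_matchings :: "nat \<Rightarrow> complex set set set" where
  "nc_matchings n = {M.
     (\<forall>e\<in>M. e \<subseteq> circle_points n \<and> card e = 2) \<and>
     (\<forall>p\<in>circle_points n. \<exists>!e. e \<in> M \<and> p \<in> e) \<and>
     (\<forall>e\<in>M. \<forall>f\<in>M. e \<noteq> f \<longrightarrow> convex hull e \<inter> convex hull f = {})}"

text \<open>Emptiness means that no other edge of the matching meets the quadrilateral. (No other edge can
  be a subset of it, since its end points are further points of the circle.)\<close>

definition spans_empty_quad :: "complex set set \<Rightarrow> complex set \<Rightarrow> complex set \<Rightarrow> bool" where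
  "spans_empty_quad M e f \<longleftrightarrow> e \<in> M \<and> f \<in> M \<and> e \<noteq> f \<and>
     (\<forall>g\<in>M - {e, f}. convex hull g \<inter> convex hull (e \<union> f) = {})"

definition quad_sides :: "complex set \<Rightarrow> complex set \<Rightarrow> complex set set" where
  "quad_sides e f =
     {s. s \<subseteq> e \<union> f \<and> card s = 2 \<and> (convex hull s) edge_of (convex hull (e \<union> f))}"

definition centered_flip :: "complex set set \<Rightarrow> complex set set \<Rightarrow> bool" where
  "centered_flip M M' \<longleftrightarrow> (\<exists>e f. spans_empty_quad M e f \<and>
     M' = (M - {e, f}) \<union> (quad_sides e f - {e, f}) \<and>
     0 \<in> convex hull (e \<union> f))"

text \<open>An undirected graph is represented by the digraph with both orientations of each edge. The
  relation \<^const>\<open>centered_flip\<close> is already symmetric on non-crossing matchings, as a flip and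
  its reverse use the same quadrilateral.\<close>

definition H_graph ::
  "nat \<Rightarrow> (complex set set, complex set set \<times> complex set set) pre_digraph" where
  "H_graph n = \<lparr>verts = nc_matchings n,
     arcs = {(M, M'). M \<in> nc_matchings n \<and> M' \<in> nc_matchings n \<and> centered_flip M M'},
     tail = fst, head = snd\<rparr>"

lemma wf_digraph_H_graph: "wf_digraph (H_graph n)"
  by unfold_locales (auto simp: H_graph_def)

text \<open>The distance of two vertices is the least number of arcs of a walk between them, and
  \<open>\<infinity>\<close> if there is none; so a finite diameter entails connectedness.\<close>

definition graph_diameter :: "('a, 'b) pre_digraph \<Rightarrow> ereal" where
  "graph_diameter G = (SUP u\<in>verts G. SUP v\<in>verts G. wf_digraph.\<mu> G (\<lambda>_. 1) u v)"

end

theory Submission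
  imports Defs
begin

text \<open>
  Cutting the disc along a matching gives a plane tree whose vertices are the faces. Write it as a
  cyclic word of branches at a face containing the centre, \<open>[X]\<close> being a branch with children \<open>X\<close>.
  For \<open>n = 2 m + 1\<close>, a centered flip turns \<open>[X]A[Y]B\<close> into \<open>X[A]Y[B]\<close>, where each of \<open>X, A, Y, B\<close> has at
  most \<open>m\<close> edges; a branch \<open>[X]\<close> with \<open>m\<close> edges in \<open>X\<close> is a diameter, and then the word can be read
  from either side of it.

  Upper bound: at most \<open>m\<close> flips produce a diameter, and one more leads to a word \<open>B[]G\<close> in which \<open>B\<close>
  and \<open>G\<close> have \<open>m\<close> edges each. From there three flips (two that produce a diameter, and one on its other
  side) turn \<open>[[Q]Y]B'[]G\<close> into \<open>[]Q[Y]B'[]G\<close>, which has more branches at the central face; words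
  starting with a leaf are rotated first. After at most \<open>3 (2 m - 2)\<close> flips all branches are leaves,
  and the parity of the starting point makes this the same star for every matching. So two matchings
  have distance at most \<open>2 (7 m - 5) \<le> 11 n - 29\<close>.

  Lower bound: the number of edges whose lower end point has an even index changes by at most one in
  a flip, and it is \<open>n\<close> for one star and at most \<open>1\<close> for the other.
\<close>

section \<open>Chords of the regular polygon\<close>

text \<open>The index is an arbitrary natural number, so an arc that passes the point of index
  \<open>0\<close> can be described by increasing indices without any reduction modulo
  \<open>2 * n\<close>.\<close>

definition pt :: "nat \<Rightarrow> nat \<Rightarrow> complex" where
  "pt n k = cis (2 * pi * real k / real (2 * n))"

lemma circle_points_eq_pt: "circle_points n = pt n ` {..<2 * n}"
  by (simp add: circle_points_def pt_def[abs_def])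

lemma pt_periodic [simp]:
  assumes "n > 0"
  shows "pt n (k + 2 * n) = pt n k"
proof -
  have "2 * pi * real (k + 2 * n) / real (2 * n) = 2 * pi * real k / real (2 * n) + 2 * pi"
    using assms by (simp add: field_simps)
  then show ?thesis
    by (simp add: pt_def cis.ctr)
qed

section \<open>Position of polygon points relative to a chord\<close>

lemma cos_less_cos_of_abs_less:
  fixes t w :: real
  assumes "\<bar>t\<bar> < w" "w \<le> pi"
  shows "cos w < cos t"
proof -
  have "cos w < cos \<bar>t\<bar>"
    using assms by (intro cos_monotone_0_pi) auto
  then show ?thesis by simp
qed

lemma cos_less_cos_of_between:
  fixes t w :: real
  assumes "0 \<le> w" "w < t" "t < 2 * pi - w"
  shows "cos t < cos w"
proof (cases "t \<le> pi")
  case True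
  then show ?thesis using assms by (intro cos_monotone_0_pi) auto
next
  case False
  then have "cos (2 * pi - t) < cos w"
    using assms by (intro cos_monotone_0_pi) auto
  then show ?thesis by simp
qed

text \<open>The unit vector towards the midpoint of the arc from \<open>i\<close> to
  \<open>j\<close>. It is normal to the chord, and \<open>chord_level\<close> is the signed distance
  of the chord from the centre along it.\<close>

definition chord_normal :: "nat \<Rightarrow> nat \<Rightarrow> nat \<Rightarrow> complex" where
  "chord_normal n i j = cis (pi * (real i + real j) / real (2 * n))"

definition chord_level :: "nat \<Rightarrow> nat \<Rightarrow> nat \<Rightarrow> real" where
  "chord_level n i j = cos (pi * (real j - real i) / real (2 * n))"

lemma inner_cis_cis: "inner (cis a) (cis b) = cos (b - a)"
  by (simp add: inner_complex_def cos_diff)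

text \<open>The inner product of unit vectors is the cosine of the angle between them, so all
  questions about sides of a chord become comparisons of cosines.\<close>

lemma inner_chord_normal_pt:
  "inner (chord_normal n i j) (pt n k) = cos (pi * (2 * real k - real i - real j) / real (2 * n))"
  unfolding chord_normal_def pt_def inner_cis_cis
  by (rule arg_cong[of _ _ cos]) (simp add: diff_divide_distrib algebra_simps add_divide_distrib)

lemma inner_chord_end:
  "inner (chord_normal n i j) (pt n i) = chord_level n i j"
  "inner (chord_normal n i j) (pt n j) = chord_level n i j"
proof -
  have "pi * (2 * real i - real i - real j) / real (2 * n) = - (pi * (real j - real i) / real (2 * n))"
    by (simp add: minus_divide_left algebra_simps del: minus_divide_left[symmetric])
  then show "inner (chord_normal n i j) (pt n i) = chord_level n i j"
    unfolding inner_chord_normal_pt chord_level_def by (metis cos_minus)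
qed (simp add: inner_chord_normal_pt chord_level_def)

lemma inner_chord_inside:
  assumes "n > 0" "i < k" "k < j" "j \<le> i + 2 * n"
  shows "chord_level n i j < inner (chord_normal n i j) (pt n k)"
  unfolding inner_chord_normal_pt chord_level_def
proof (rule cos_less_cos_of_abs_less)
  have "\<bar>2 * real k - real i - real j\<bar> < real j - real i"
    using assms by linarith
  then show "\<bar>pi * (2 * real k - real i - real j) / real (2 * n)\<bar> < pi * (real j - real i) / real (2 * n)"
    using assms(1) by (simp add: abs_mult divide_strict_right_mono)
  have "pi * (real j - real i) \<le> pi * real (2 * n)"
    using assms by (intro mult_left_mono) auto
  then show "pi * (real j - real i) / real (2 * n) \<le> pi"
    using assms(1) by (simp add: pos_divide_le_eq)
qed

lemma inner_chord_outside_strict: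
  assumes "n > 0" "i \<le> j" "j < k" "k < i + 2 * n"
  shows "inner (chord_normal n i j) (pt n k) < chord_level n i j"
  unfolding inner_chord_normal_pt chord_level_def
proof (rule cos_less_cos_of_between)
  show "0 \<le> pi * (real j - real i) / real (2 * n)"
    using assms by simp
  show "pi * (real j - real i) / real (2 * n) < pi * (2 * real k - real i - real j) / real (2 * n)"
    using assms by (intro divide_strict_right_mono mult_strict_left_mono) auto
  have "2 * real k - real i - real j + (real j - real i) < 2 * real (2 * n)"
    using assms by linarith
  then have "pi * (2 * real k - real i - real j + (real j - real i)) / real (2 * n)
      < pi * (2 * real (2 * n)) / real (2 * n)"
    using assms by (intro divide_strict_right_mono mult_strict_left_mono) auto
  also have "\<dots> = 2 * pi"
    using assms(1) by simp
  finally show "pi * (2 * real k - real i - real j) / real (2 * n)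
      < 2 * pi - pi * (real j - real i) / real (2 * n)"
    unfolding distrib_left add_divide_distrib by linarith
qed

lemma inner_chord_outside:
  assumes "n > 0" "i \<le> j" "j \<le> k" "k \<le> i + 2 * n"
  shows "inner (chord_normal n i j) (pt n k) \<le> chord_level n i j"
proof -
  consider "k = j" | "k = i + 2 * n" | "j < k" "k < i + 2 * n"
    using assms by linarith
  then show ?thesis
    using assms inner_chord_outside_strict[OF assms(1,2)]
    by cases (auto simp: inner_chord_end intro: less_imp_le)
qed

lemma pt_neq:
  assumes "n > 0" "i < j" "j < i + 2 * n"
  shows "pt n i \<noteq> pt n j"
  using inner_chord_outside_strict[of n i i j] inner_chord_end(1)[of n i i] assms by auto

lemma pt_eq_iff:
  assumes "n > 0" "s \<le> i" "i < s + 2 * n" "s \<le> j" "j < s + 2 * n"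
  shows "pt n i = pt n j \<longleftrightarrow> i = j"
  using pt_neq[of n i j] pt_neq[of n j i] assms by (cases i j rule: linorder_cases) auto

text \<open>The line through the chord separates the hulls. Only the side of \<open>S\<close> is
  strict, so \<open>T\<close> may contain the end points of the chord.\<close>

lemma hulls_disjoint_of_arcs:
  assumes "n > 0" "i \<le> j" "j \<le> i + 2 * n"
    and S: "\<And>k. k \<in> S \<Longrightarrow> i < k \<and> k < j"
    and T: "\<And>k. k \<in> T \<Longrightarrow> j \<le> k \<and> k \<le> i + 2 * n"
  shows "convex hull (pt n ` S) \<inter> convex hull (pt n ` T) = {}"
proof -
  let ?u = "chord_normal n i j" and ?c = "chord_level n i j"
  have "convex hull (pt n ` S) \<subseteq> {x. inner ?u x > ?c}"
    using S assms(1,3) by (intro hull_minimal convex_halfspace_gt) (auto intro: inner_chord_inside)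
  moreover have "convex hull (pt n ` T) \<subseteq> {x. inner ?u x \<le> ?c}"
    using T assms(1,2) by (intro hull_minimal convex_halfspace_le) (auto intro: inner_chord_outside)
  ultimately show ?thesis by fastforce
qed

text \<open>The points \<open>k\<close> and \<open>l\<close> lie strictly on different sides of the
  line through \<open>i\<close> and \<open>j\<close>, so the segment between them meets this line.
  The meeting point is in the unit disc, and the line meets the disc exactly in the chord.\<close>

lemma chords_cross:
  assumes "n > 0" "i < k" "k < j" "j < l" "l < i + 2 * n"
  obtains z where "z \<in> open_segment (pt n k) (pt n l)" "z \<in> convex hull {pt n i, pt n j}"
proof -
  define u where "u = chord_normal n i j"
  define w where "w = pi * (real j - real i) / real (2 * n)"
  define g where "g x = inner u x" for x
  have gk: "cos w < g (pt n k)"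
    using inner_chord_inside[of n i k j] assms by (simp add: g_def u_def w_def chord_level_def)
  have gl: "g (pt n l) < cos w"
    using inner_chord_outside_strict[of n i j l] assms by (simp add: g_def u_def w_def chord_level_def)
  \<comment> \<open>Along the segment from \<open>k\<close> to \<open>l\<close> the function
    \<open>g\<close> is affine; \<open>t\<close> is the parameter at which it takes the value
    \<open>cos w\<close>.\<close>
  define t where "t = (g (pt n k) - cos w) / (g (pt n k) - g (pt n l))"
  have t: "0 < t" "t < 1"
    using gk gl by (auto simp: t_def field_simps)
  define z where "z = (1 - t) *\<^sub>R pt n k + t *\<^sub>R pt n l"
  have "g z = g (pt n k) - t * (g (pt n k) - g (pt n l))"
    by (simp add: g_def z_def inner_add_right algebra_simps)
  also have "\<dots> = cos w"
    using gk gl by (simp add: t_def)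
  finally have gz: "g z = cos w" .
  have zseg: "z \<in> open_segment (pt n k) (pt n l)"
    using t pt_neq[of n k l] assms unfolding in_segment z_def by auto
  have "norm z \<le> (1 - t) * norm (pt n k) + t * norm (pt n l)"
    unfolding z_def using norm_triangle_ineq t by (smt (verit) norm_scaleR)
  then have nz: "norm z \<le> 1"
    by (simp add: pt_def)
  have u1: "u * cnj u = 1" "norm u = 1"
    by (simp_all add: u_def chord_normal_def cis_cnj cis_mult)
  \<comment> \<open>The rotation by \<open>cnj u\<close> makes the chord vertical, with end points
    \<open>cis (- w)\<close> and \<open>cis w\<close>. It remains to bound the imaginary part of
    \<open>v\<close> by \<open>sin w\<close>.\<close>
  define v where "v = z * cnj u"
  have zv: "z = u * v"
    using u1 by (simp add: v_def mult.left_commute)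
  have Rev: "Re v = cos w"
    using gz by (simp add: v_def g_def inner_complex_def algebra_simps)
  have "norm v \<le> 1"
    using nz u1 by (simp add: v_def norm_mult)
  then have "(Re v)\<^sup>2 + (Im v)\<^sup>2 \<le> 1"
    using cmod_power2[of v] power_le_one[of "norm v" 2] by simp
  then have Im_sq: "(Im v)\<^sup>2 \<le> (sin w)\<^sup>2"
    unfolding Rev using sin_cos_squared_add[of w] by linarith
  have "0 < w"
    using assms by (simp add: w_def)
  moreover have "pi * (real j - real i) < pi * real (2 * n)"
    using assms by (intro mult_strict_left_mono) auto
  then have "w < pi"
    using assms(1) by (simp add: w_def pos_divide_less_eq)
  ultimately have sw: "sin w > 0"
    by (intro sin_gt_zero)
  have Imv: "\<bar>Im v\<bar> \<le> sin w"
    using Im_sq sw by (metis abs_le_square_iff abs_of_pos)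
  define r where "r = (Im v + sin w) / (2 * sin w)"
  have r: "0 \<le> r" "r \<le> 1"
    using Imv sw by (auto simp: r_def field_simps)
  have "Im v = 2 * r * sin w - sin w"
    using sw by (simp add: r_def field_simps)
  then have v: "v = (1 - r) *\<^sub>R cis (- w) + r *\<^sub>R cis w"
    using Rev by (simp add: complex_eq_iff algebra_simps)
  have pti: "pt n i = u * cis (- w)" and ptj: "pt n j = u * cis w"
    unfolding pt_def u_def chord_normal_def cis_mult w_def
    by (rule arg_cong[of _ _ cis], simp add: add_divide_distrib diff_divide_distrib algebra_simps)+
  have "z = (1 - r) *\<^sub>R pt n i + r *\<^sub>R pt n j"
    unfolding zv v pti ptj by (simp add: algebra_simps)
  then have "z \<in> closed_segment (pt n i) (pt n j)"
    using r unfolding in_segment by blast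
  with zseg show thesis
    using that by (simp add: segment_convex_hull)
qed

section \<open>Quadrilaterals: when they contain the centre, and which chords are their
  sides\<close>

lemma cos_nonneg_at_near_end:
  fixes x y p :: real
  assumes "x \<le> p" "p \<le> y" "y - x \<le> pi"
  shows "0 \<le> cos (p - x) \<or> 0 \<le> cos (p - y)"
proof (cases "p - x \<le> pi / 2")
  case True
  then show ?thesis using assms by (auto intro: cos_ge_zero)
next
  case False
  then have "0 \<le> cos (p - y)" using assms by (intro cos_ge_zero) auto
  then show ?thesis ..
qed

text \<open>Otherwise some \<open>u\<close> has positive inner product with all four vertices. The
  direction opposite to \<open>u\<close> falls into one of the four gaps; since no gap exceeds a
  half circle, it is within a right angle of a vertex, a contradiction.\<close>

lemma zero_in_quad:
  assumes n: "n > 0" and "a < b" "b < c" "c < d" "d < a + 2 * n"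
    and "b \<le> a + n" "c \<le> b + n" "d \<le> c + n" "a + n \<le> d"
  shows "0 \<in> convex hull {pt n a, pt n b, pt n c, pt n d}"
proof (rule ccontr)
  assume "0 \<notin> convex hull {pt n a, pt n b, pt n c, pt n d}"
  moreover have "closed (convex hull {pt n a, pt n b, pt n c, pt n d})"
    by (intro compact_imp_closed finite_imp_compact_convex_hull) simp
  ultimately obtain u \<delta> where "\<delta> > 0"
      "\<forall>x \<in> convex hull {pt n a, pt n b, pt n c, pt n d}. inner u x > \<delta>"
    using separating_hyperplane_closed_0[OF convex_convex_hull] by blast
  then have u: "inner u x > 0" if "x \<in> convex hull {pt n a, pt n b, pt n c, pt n d}" for x
    using that by fastforce
  define t where "t k = pi * real k / real n" for k
  have tdiff: "t j - t i \<le> pi" if "j \<le> i + n" for i j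
  proof -
    have "pi * real j \<le> pi * (real i + real n)"
      using that by (intro mult_left_mono) auto
    then show ?thesis
      using n by (simp add: t_def diff_divide_distrib[symmetric] pos_divide_le_eq algebra_simps)
  qed
  have tmono: "t i \<le> t j" if "i \<le> j" for i j
    using that n by (simp add: t_def divide_right_mono)
  have ptt: "pt n k = cis (t k)" for k
    using n by (simp add: pt_def t_def)
  \<comment> \<open>\<open>z\<close> counts the full turns to remove, so that the angle
    \<open>p\<close> of the direction opposite to \<open>u\<close> lies in the turn that starts at
    vertex \<open>a\<close>.\<close>
  define z where "z = \<lfloor>(Arg u + pi - t a) / (2 * pi)\<rfloor>"
  define p where "p = Arg u + pi - 2 * pi * of_int z"
  have neg: "cos (p - t k) < 0" if "pt n k \<in> {pt n a, pt n b, pt n c, pt n d}" for k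
  proof -
    have "0 < inner u (pt n k)"
      using that by (intro u hull_inc) auto
    also have "u = norm u *\<^sub>R cis (Arg u)"
      by (metis rcis_cmod_Arg rcis_def scaleR_conv_of_real)
    also have "inner (norm u *\<^sub>R cis (Arg u)) (pt n k) = norm u * cos (t k - Arg u)"
      by (simp add: ptt inner_cis_cis)
    finally have "0 < cos (Arg u - t k)"
      using cos_minus[of "Arg u - t k"] by (simp add: zero_less_mult_iff)
    moreover have "cos (p - t k) = cos ((Arg u - t k + pi) - of_int z * (2 * pi))"
      by (simp add: p_def algebra_simps)
    moreover have "\<dots> = cos (Arg u - t k + pi)"
      using cos.plus_of_int[of "Arg u - t k + pi - of_int z * (2 * pi)" z] by (simp add: mult.commute)
    ultimately show ?thesis by simp
  qed
  have "of_int z \<le> (Arg u + pi - t a) / (2 * pi)" "(Arg u + pi - t a) / (2 * pi) < of_int z + 1"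
    unfolding z_def by linarith+
  then have p: "t a \<le> p" "p \<le> t a + 2 * pi"
    unfolding p_def by (simp_all add: field_simps)
  have ta: "t (a + 2 * n) = t a + 2 * pi"
    using n by (simp add: t_def field_simps)
  have gap: False if "t i \<le> p" "p \<le> t j" "j \<le> i + n" "i \<in> {a, b, c, d}" "j \<in> {b, c, d, a + 2 * n}" for i j
  proof -
    have "pt n i \<in> {pt n a, pt n b, pt n c, pt n d}" "pt n j \<in> {pt n a, pt n b, pt n c, pt n d}"
      using that(4,5) n by auto
    then show False
      using cos_nonneg_at_near_end[OF that(1,2) tdiff[OF that(3)]] neg[of i] neg[of j] by linarith
  qed
  consider "p \<le> t b" | "t b \<le> p" "p \<le> t c" | "t c \<le> p" "p \<le> t d" | "t d \<le> p"
    by linarith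
  then show False
    using gap[of a b] gap[of b c] gap[of c d] gap[of d "a + 2 * n"] p assms ta by cases auto
qed

text \<open>The line through the two points supports the polygon: all other vertices are strictly on
  one side, so the affine hull of the pair misses their hull.\<close>

lemma polygon_side_edge_of:
  assumes "n > 0" "i < j" "j < i + 2 * n" "finite T"
    and T: "\<And>k. k \<in> T \<Longrightarrow> j < k \<and> k < i + 2 * n"
  shows "(convex hull {pt n i, pt n j}) edge_of (convex hull (insert (pt n i) (insert (pt n j) (pt n ` T))))"
  unfolding edge_of_def
proof
  let ?S = "insert (pt n i) (insert (pt n j) (pt n ` T))"
  let ?u = "chord_normal n i j" and ?c = "chord_level n i j"
  have "affine hull {pt n i, pt n j} \<subseteq> {x. inner ?u x = ?c}"
    by (intro hull_minimal affine_hyperplane) (auto simp: inner_chord_end)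
  moreover have "convex hull (?S - {pt n i, pt n j}) \<subseteq> {x. inner ?u x < ?c}"
    using T assms(1,2) by (intro hull_minimal convex_halfspace_lt) (auto intro: inner_chord_outside_strict)
  ultimately show "(convex hull {pt n i, pt n j}) face_of (convex hull ?S)"
    using assms(4) by (intro face_of_convex_hulls) fastforce+
  show "aff_dim (convex hull {pt n i, pt n j}) = 1"
    using pt_neq[OF assms(1-3)] by (simp add: aff_dim_convex_hull aff_dim_2)
qed

text \<open>A face that contains an inner point of the crossing chord contains its end
  \<open>k\<close> too, but \<open>k\<close> is strictly off the line through \<open>i\<close> and
  \<open>j\<close>.\<close>

lemma polygon_diagonal_not_face_of:
  assumes "n > 0" "i < k" "k < j" "j < l" "l < i + 2 * n"
    and S: "{pt n i, pt n j, pt n k, pt n l} \<subseteq> S"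
  shows "\<not> (convex hull {pt n i, pt n j}) face_of (convex hull S)"
proof
  assume face: "(convex hull {pt n i, pt n j}) face_of (convex hull S)"
  obtain z where "z \<in> open_segment (pt n k) (pt n l)" "z \<in> convex hull {pt n i, pt n j}"
    using chords_cross[OF assms(1-5)] .
  then have "pt n k \<in> convex hull {pt n i, pt n j}"
    using face_ofD[OF face] S by (meson hull_inc insert_subset)
  moreover have "convex hull {pt n i, pt n j} \<subseteq> {x. inner (chord_normal n i j) x \<le> chord_level n i j}"
    by (intro hull_minimal convex_halfspace_le) (auto simp: inner_chord_end)
  ultimately show False
    using inner_chord_inside[of n i k j] assms by auto
qed

lemma quad_sides_pt:
  assumes n: "n > 0" and "a < b" "b < c" "c < d" "d < a + 2 * n"
  shows "quad_sides {pt n a, pt n b} {pt n c, pt n d} =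
    {{pt n a, pt n b}, {pt n b, pt n c}, {pt n c, pt n d}, {pt n d, pt n a}}" (is "?L = ?R")
proof
  let ?A = "pt n a" and ?B = "pt n b" and ?C = "pt n c" and ?D = "pt n d"
  let ?S = "{?A, ?B} \<union> {?C, ?D}"
  have per: "pt n (a + 2 * n) = ?A" "pt n (b + 2 * n) = ?B" "pt n (c + 2 * n) = ?C"
    using n by simp_all
  have "\<not> (convex hull {?A, ?C}) edge_of (convex hull ?S)"
    using polygon_diagonal_not_face_of[of n a b c d ?S] assms by (auto simp: edge_of_def)
  moreover have "\<not> (convex hull {?B, ?D}) edge_of (convex hull ?S)"
    using polygon_diagonal_not_face_of[of n b c d "a + 2 * n" ?S] assms per
    by (auto simp: edge_of_def)
  ultimately have diag: "\<not> (convex hull {?A, ?C}) edge_of (convex hull ?S)"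
      "\<not> (convex hull {?C, ?A}) edge_of (convex hull ?S)"
      "\<not> (convex hull {?B, ?D}) edge_of (convex hull ?S)"
      "\<not> (convex hull {?D, ?B}) edge_of (convex hull ?S)"
    by (simp_all add: insert_commute[of ?C ?A] insert_commute[of ?D ?B])
  show "?L \<subseteq> ?R"
  proof
    fix s assume "s \<in> ?L"
    then obtain x y where s: "s = {x, y}" "x \<noteq> y" "x \<in> ?S" "y \<in> ?S"
      and edge: "(convex hull {x, y}) edge_of (convex hull ?S)"
      by (auto simp: quad_sides_def card_2_iff)
    have "x = ?A \<or> x = ?B \<or> x = ?C \<or> x = ?D" "y = ?A \<or> y = ?B \<or> y = ?C \<or> y = ?D"
      using s by blast+
    then show "s \<in> ?R"
      using s(2) edge diag unfolding s(1) by (elim disjE) (simp_all add: doubleton_eq_iff)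
  qed
  have dist: "?A \<noteq> ?B" "?A \<noteq> ?C" "?A \<noteq> ?D" "?B \<noteq> ?C" "?B \<noteq> ?D" "?C \<noteq> ?D"
    using assms by (auto simp: pt_eq_iff[of n a])
  \<comment> \<open>Each side is treated as the first pair in turn; the other vertices are indexed
    behind it, with \<open>2 * n\<close> added where the order requires it.\<close>
  have S1: "insert ?A (insert ?B (pt n ` {c, d})) = ?S"
    using per by auto
  have e1: "(convex hull {?A, ?B}) edge_of (convex hull ?S)"
    by (rule polygon_side_edge_of[where n = n and i = "a" and j = "b" and T = "{c, d}",
        unfolded per S1, OF n]) (use assms in auto)
  have S2: "insert ?B (insert ?C (pt n ` {d, a + 2 * n})) = ?S"
    using per by auto
  have e2: "(convex hull {?B, ?C}) edge_of (convex hull ?S)"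
    by (rule polygon_side_edge_of[where n = n and i = "b" and j = "c" and T = "{d, a + 2 * n}",
        unfolded per S2, OF n]) (use assms in auto)
  have S3: "insert ?C (insert ?D (pt n ` {a + 2 * n, b + 2 * n})) = ?S"
    using per by auto
  have e3: "(convex hull {?C, ?D}) edge_of (convex hull ?S)"
    by (rule polygon_side_edge_of[where n = n and i = "c" and j = "d" and T = "{a + 2 * n, b + 2 * n}",
        unfolded per S3, OF n]) (use assms in auto)
  have S4: "insert ?D (insert ?A (pt n ` {b + 2 * n, c + 2 * n})) = ?S"
    using per by auto
  have e4: "(convex hull {?D, ?A}) edge_of (convex hull ?S)"
    by (rule polygon_side_edge_of[where n = n and i = "d" and j = "a + 2 * n" and T = "{b + 2 * n, c + 2 * n}",
        unfolded per S4, OF n]) (use assms in auto)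
  show "?R \<subseteq> ?L"
    using dist e1 e2 e3 e4 unfolding quad_sides_def by auto
qed

section \<open>Matchings as plane forests\<close>

datatype ptree = Node "ptree list"

fun nedges :: "ptree list \<Rightarrow> nat" where
  "nedges [] = 0"
| "nedges (Node X # F) = Suc (nedges X + nedges F)"

text \<open>The forest is read as a balanced bracket word starting at position \<open>s\<close>; the
  pairs are the positions of matching brackets.\<close>

fun pairs :: "nat \<Rightarrow> ptree list \<Rightarrow> (nat \<times> nat) set" where
  "pairs s [] = {}"
| "pairs s (Node X # F) = insert (s, s + 2 * nedges X + 1)
     (pairs (s + 1) X \<union> pairs (s + 2 * nedges X + 2) F)"

definition matching :: "nat \<Rightarrow> nat \<Rightarrow> ptree list \<Rightarrow> complex set set" where
  "matching n s F = (\<lambda>(i, j). {pt n i, pt n j}) ` pairs s F"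

lemma matching_iff: "e \<in> matching n s F \<longleftrightarrow> (\<exists>i j. (i, j) \<in> pairs s F \<and> e = {pt n i, pt n j})"
  by (force simp: matching_def)

lemma nedges_append [simp]: "nedges (F @ G) = nedges F + nedges G"
  by (induction F rule: nedges.induct) auto

lemma nedges_replicate_leaf [simp]: "nedges (replicate k (Node [])) = k"
  by (induction k) auto

lemma pairs_append: "pairs s (F @ G) = pairs s F \<union> pairs (s + 2 * nedges F) G"
  by (induction s F rule: pairs.induct) (auto simp: algebra_simps)

lemma pairs_shift: "pairs (s + c) F = (\<lambda>(i, j). (i + c, j + c)) ` pairs s F"
proof (induction s F rule: pairs.induct)
  case (2 s X F)
  have "pairs (s + c + 1) X = (\<lambda>(i, j). (i + c, j + c)) ` pairs (s + 1) X"
    using 2(1) by (simp add: ac_simps)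
  moreover have "pairs (s + c + 2 * nedges X + 2) F =
      (\<lambda>(i, j). (i + c, j + c)) ` pairs (s + 2 * nedges X + 2) F"
    using 2(2) by (simp add: ac_simps)
  ultimately show ?case
    by (simp add: image_Un ac_simps)
qed simp

lemma pairs_bounds:
  "(i, j) \<in> pairs s F \<Longrightarrow> s \<le> i \<and> i < j \<and> j < s + 2 * nedges F"
  by (induction s F rule: pairs.induct) (fastforce)+

lemma pairs_cover:
  "s \<le> k \<Longrightarrow> k < s + 2 * nedges F \<Longrightarrow> \<exists>i j. (i, j) \<in> pairs s F \<and> (k = i \<or> k = j)"
proof (induction s F rule: pairs.induct)
  case (2 s X F)
  consider "k = s \<or> k = s + 2 * nedges X + 1" | "s + 1 \<le> k" "k < s + 1 + 2 * nedges X"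
    | "s + 2 * nedges X + 2 \<le> k" "k < s + 2 * nedges X + 2 + 2 * nedges F"
    using 2(3,4) by (simp, linarith)
  then show ?case
  proof cases
    case 1
    then show ?thesis
      by (intro exI[of _ s] exI[of _ "s + 2 * nedges X + 1"]) simp
  next
    case 2
    from "2.IH"(1)[OF this] show ?thesis by auto
  next
    case 3
    from "2.IH"(2)[OF this] show ?thesis by auto
  qed
qed simp

lemma pairs_noncrossing:
  "(i, j) \<in> pairs s F \<Longrightarrow> (k, l) \<in> pairs s F \<Longrightarrow> (i, j) \<noteq> (k, l) \<Longrightarrow>
    j < k \<or> l < i \<or> (i < k \<and> l < j) \<or> (k < i \<and> j < l)"
proof (induction s F rule: pairs.induct)
  case (2 s X F)
  let ?e = "s + 2 * nedges X + 1"
  have X: "s < i \<and> i < j \<and> j < ?e" if "(i, j) \<in> pairs (s + 1) X" for i j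
    using pairs_bounds[OF that] by linarith
  have F: "?e < i \<and> i < j" if "(i, j) \<in> pairs (s + 2 * nedges X + 2) F" for i j
    using pairs_bounds[OF that] by linarith
  consider "(i, j) = (s, ?e)" | "(i, j) \<in> pairs (s + 1) X" | "(i, j) \<in> pairs (s + 2 * nedges X + 2) F"
    using "2.prems"(1) by auto
  note ij = this
  consider "(k, l) = (s, ?e)" | "(k, l) \<in> pairs (s + 1) X" | "(k, l) \<in> pairs (s + 2 * nedges X + 2) F"
    using "2.prems"(2) by auto
  then show ?case
  proof cases
    case 1
    then show ?thesis using ij "2.prems"(3) X[of i j] F[of i j] by cases auto
  next
    case 2
    from ij show ?thesis
    proof cases
      case 1
      then show ?thesis using X[OF 2] by auto
    next
      case 22: 2
      then show ?thesis using "2.IH"(1)[OF 22 2 "2.prems"(3)] by blast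
    next
      case 3
      then show ?thesis using X[OF 2] F[OF 3] by linarith
    qed
  next
    case 3
    from ij show ?thesis
    proof cases
      case 1
      then show ?thesis using F[OF 3] by auto
    next
      case 2
      then show ?thesis using X[OF 2] F[OF 3] by linarith
    next
      case 33: 3
      then show ?thesis using "2.IH"(2)[OF 33 3 "2.prems"(3)] by blast
    qed
  qed
qed simp

lemma matching_append: "matching n s (F @ G) = matching n s F \<union> matching n (s + 2 * nedges F) G"
  by (simp add: matching_def pairs_append image_Un)

lemma matching_Cons:
  "matching n s (Node X # F) = insert {pt n s, pt n (s + 2 * nedges X + 1)}
     (matching n (s + 1) X \<union> matching n (s + 2 * nedges X + 2) F)"
  by (simp add: matching_def image_Un)

lemma matching_Nil [simp]: "matching n s [] = {}"
  by (simp add: matching_def)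

lemma matching_period:
  assumes "n > 0"
  shows "matching n (s + 2 * n) F = matching n s F"
  unfolding matching_def pairs_shift using assms by (auto simp: image_image case_prod_unfold)

text \<open>The start moves past the branches \<open>F\<close> at the same face; by periodicity they
  may be read one full turn later.\<close>

lemma matching_rotate:
  assumes "n > 0" "nedges F + nedges G = n"
  shows "matching n s (F @ G) = matching n (s + 2 * nedges F) (G @ F)"
proof -
  have "s + 2 * nedges F + 2 * nedges G = s + 2 * n"
    using assms by simp
  then show ?thesis
    using matching_period[OF assms(1), of s F] by (simp only: matching_append Un_commute)
qed

text \<open>The root face moves across the edge of the first branch: the children \<open>X\<close>
  become branches, and everything else hangs behind the same edge seen from its other side.\<close>

lemma matching_reroot:
  assumes "n > 0" "nedges X + nedges R + 1 = n"
  shows "matching n s (Node X # R) = matching n (s + 1) (X @ [Node R])"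
proof -
  have e: "s + 1 + 2 * nedges X + 2 * nedges R + 1 = s + 2 * n"
    using assms by simp
  have "{pt n s, pt n (s + 2 * nedges X + 1)} = {pt n (s + 1 + 2 * nedges X), pt n (s + 2 * n)}"
    using assms(1) by (simp add: insert_commute)
  then show ?thesis
    unfolding matching_append matching_Cons e by (simp add: ac_simps)
qed

section \<open>From forests to non-crossing matchings\<close>

lemma circle_points_eq_interval:
  assumes "n > 0"
  shows "circle_points n = pt n ` {s..<s + 2 * n}"
proof (induction s)
  case 0
  then show ?case by (simp add: circle_points_eq_pt lessThan_atLeast0)
next
  case (Suc s)
  have "{s..<s + 2 * n} = insert s {Suc s..<s + 2 * n}" "{Suc s..<Suc s + 2 * n} = insert (s + 2 * n) {Suc s..<s + 2 * n}"
    using assms by auto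
  then show ?case
    using Suc assms by simp
qed

text \<open>Two bracket pairs are consecutive or nested. In both cases one edge has its end points
  strictly inside an arc cut off by the other, so the hulls are separated.\<close>

lemma matching_in_nc_matchings:
  assumes n: "n > 0" and F: "nedges F = n"
  shows "matching n s F \<in> nc_matchings n"
proof -
  have bd: "s \<le> i \<and> i < j \<and> j < s + 2 * n" if "(i, j) \<in> pairs s F" for i j
    using pairs_bounds[OF that] F by simp
  have inj: "pt n i = pt n j \<longleftrightarrow> i = j" if "s \<le> i" "i < s + 2 * n" "s \<le> j" "j < s + 2 * n" for i j
    using pt_eq_iff[OF n that] .
  have c1: "e \<subseteq> circle_points n \<and> card e = 2" if e: "e \<in> matching n s F" for e
  proof -
    obtain i j where ij: "(i, j) \<in> pairs s F" "e = {pt n i, pt n j}"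
      using e unfolding matching_iff by blast
    moreover have "pt n i \<in> circle_points n" "pt n j \<in> circle_points n"
      using bd[OF ij(1)] unfolding circle_points_eq_interval[OF n, of s] by auto
    ultimately show ?thesis
      using bd[OF ij(1)] inj[of i j] by auto
  qed
  have c2: "\<exists>!e. e \<in> matching n s F \<and> p \<in> e" if p: "p \<in> circle_points n" for p
  proof -
    obtain k where k: "s \<le> k" "k < s + 2 * n" "p = pt n k"
      using p unfolding circle_points_eq_interval[OF n, of s] by auto
    then obtain i j where ij: "(i, j) \<in> pairs s F" "k = i \<or> k = j"
      using pairs_cover[of s k F] F by auto
    show ?thesis
    proof (rule ex1I[of _ "{pt n i, pt n j}"])
      show "{pt n i, pt n j} \<in> matching n s F \<and> p \<in> {pt n i, pt n j}"
        using ij k unfolding matching_iff by blast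
      fix e assume "e \<in> matching n s F \<and> p \<in> e"
      then obtain i' j' where ij': "(i', j') \<in> pairs s F" "e = {pt n i', pt n j'}" "pt n k \<in> e"
        unfolding matching_iff k(3) by blast
      then have k': "k = i' \<or> k = j'"
        using bd[OF ij'(1)] k inj[of k i'] inj[of k j'] by auto
      have "(i, j) = (i', j')"
      proof (rule ccontr)
        assume "(i, j) \<noteq> (i', j')"
        from pairs_noncrossing[OF ij(1) ij'(1) this] show False
          using bd[OF ij(1)] bd[OF ij'(1)] ij(2) k' by (elim disjE) simp_all
      qed
      then show "e = {pt n i, pt n j}"
        using ij' by simp
    qed
  qed
  have c3: "convex hull e \<inter> convex hull f = {}"
    if e: "e \<in> matching n s F" and f: "f \<in> matching n s F" and "e \<noteq> f" for e f
  proof -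
    have before: "convex hull {pt n i, pt n j} \<inter> convex hull {pt n k, pt n l} = {}"
      if "i < j" "j < k" "k < l" "l < i + 2 * n" for i j k l
    proof -
      have "convex hull (pt n ` {k, l}) \<inter> convex hull (pt n ` {i + 2 * n, j + 2 * n}) = {}"
        by (rule hulls_disjoint_of_arcs[of n j "i + 2 * n"]) (use that n in auto)
      then show ?thesis
        using n by (simp add: Int_commute)
    qed
    have nested: "convex hull {pt n k, pt n l} \<inter> convex hull {pt n i, pt n j} = {}"
      if "i < k" "k < l" "l < j" "j < i + 2 * n" for i j k l
    proof -
      have "convex hull (pt n ` {k, l}) \<inter> convex hull (pt n ` {j, i + 2 * n}) = {}"
        by (rule hulls_disjoint_of_arcs[of n i j]) (use that n in auto)
      then show ?thesis
        using n by (simp add: insert_commute)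
    qed
    obtain i j where ij: "(i, j) \<in> pairs s F" "e = {pt n i, pt n j}"
      using e unfolding matching_iff by blast
    obtain k l where kl: "(k, l) \<in> pairs s F" "f = {pt n k, pt n l}"
      using f unfolding matching_iff by blast
    have "(i, j) \<noteq> (k, l)"
      using \<open>e \<noteq> f\<close> ij kl by auto
    then consider "j < k" | "l < i" | "i < k" "l < j" | "k < i" "j < l"
      using pairs_noncrossing[OF ij(1) kl(1)] by blast
    then show ?thesis
    proof cases
      case 1
      then show ?thesis using before[of i j k l] bd[OF ij(1)] bd[OF kl(1)] ij kl by simp
    next
      case 2
      then show ?thesis using before[of k l i j] bd[OF ij(1)] bd[OF kl(1)] ij kl
        by (simp add: Int_commute)
    next
      case 3
      then show ?thesis using nested[of i k l j] bd[OF ij(1)] bd[OF kl(1)] ij kl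
        by (simp add: Int_commute)
    next
      case 4
      then show ?thesis using nested[of k i j l] bd[OF ij(1)] bd[OF kl(1)] ij kl by simp
    qed
  qed
  show ?thesis
    unfolding nc_matchings_def mem_Collect_eq by (intro conjI ballI impI c1 c2 c3; assumption)
qed

section \<open>From non-crossing matchings to forests\<close>

text \<open>Induction on the length of the interval. The pair that opens at \<open>s\<close> closes
  at some \<open>j\<close>; no pair crosses it, so the positions between \<open>s\<close> and
  \<open>j\<close> and those after \<open>j\<close> are covered separately and give the first tree
  and the rest of the forest.\<close>

lemma noncrossing_pairs_eq_forest_pairs:
  fixes P :: "(nat \<times> nat) set"
  assumes less: "\<And>i j. (i, j) \<in> P \<Longrightarrow> i < j"
    and disj: "\<And>i j k l. (i, j) \<in> P \<Longrightarrow> (k, l) \<in> P \<Longrightarrow> k = i \<or> k = j \<or> l = j \<Longrightarrow> (i, j) = (k, l)"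
    and noncr: "\<And>i j k l. (i, j) \<in> P \<Longrightarrow> (k, l) \<in> P \<Longrightarrow> i < k \<Longrightarrow> k < j \<Longrightarrow> l < j"
    and "s \<le> t"
    and cover: "\<And>k. s \<le> k \<Longrightarrow> k < t \<Longrightarrow> \<exists>i j. (i, j) \<in> P \<and> s \<le> i \<and> j < t \<and> (k = i \<or> k = j)"
  shows "\<exists>F. t = s + 2 * nedges F \<and> {(i, j) \<in> P. s \<le> i \<and> j < t} = pairs s F"
  using assms(4,5)
proof (induction "t - s" arbitrary: s t rule: less_induct)
  case less
  note cover = less.prems(2)
  show ?case
  proof (cases "s = t")
    case True
    then show ?thesis
      using assms(1) by (intro exI[of _ "[]"]) fastforce
  next
    case False
    then obtain i j where "(i, j) \<in> P" "s \<le> i" "j < t" "s = i \<or> s = j"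
      using cover[of s] less.prems(1) by auto
    then have j: "(s, j) \<in> P" "s < j" "j < t"
      using assms(1)[of i j] by auto
    have "\<exists>X. j = Suc s + 2 * nedges X \<and> {(i, j') \<in> P. Suc s \<le> i \<and> j' < j} = pairs (Suc s) X"
    proof (rule less.hyps)
      fix k assume k: "Suc s \<le> k" "k < j"
      then obtain a b where ab: "(a, b) \<in> P" "s \<le> a" "b < t" "k = a \<or> k = b"
        using cover[of k] j by auto
      have "a \<noteq> s"
        using disj[OF j(1) ab(1)] ab k by auto
      then show "\<exists>i j'. (i, j') \<in> P \<and> Suc s \<le> i \<and> j' < j \<and> (k = i \<or> k = j')"
        using noncr[OF j(1) ab(1)] ab k by (intro exI[of _ a] exI[of _ b]) auto
    qed (use j in auto)
    then obtain X where X: "j = Suc s + 2 * nedges X"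
        "{(i, j') \<in> P. Suc s \<le> i \<and> j' < j} = pairs (Suc s) X"
      by blast
    have "\<exists>G. t = Suc j + 2 * nedges G \<and> {(i, j') \<in> P. Suc j \<le> i \<and> j' < t} = pairs (Suc j) G"
    proof (rule less.hyps)
      fix k assume k: "Suc j \<le> k" "k < t"
      then obtain a b where ab: "(a, b) \<in> P" "s \<le> a" "b < t" "k = a \<or> k = b"
        using cover[of k] j by auto
      have "a \<noteq> s" "a \<noteq> j"
        using disj[OF j(1) ab(1)] ab k j by auto
      moreover have "\<not> a < j"
        using noncr[OF j(1) ab(1)] ab k \<open>a \<noteq> s\<close> by auto
      ultimately show "\<exists>i j'. (i, j') \<in> P \<and> Suc j \<le> i \<and> j' < t \<and> (k = i \<or> k = j')"
        using ab by (intro exI[of _ a] exI[of _ b]) auto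
    qed (use j in auto)
    then obtain G where G: "t = Suc j + 2 * nedges G"
        "{(i, j') \<in> P. Suc j \<le> i \<and> j' < t} = pairs (Suc j) G"
      by blast
    have "{(i, k) \<in> P. s \<le> i \<and> k < t} = insert (s, j)
        ({(i, j') \<in> P. Suc s \<le> i \<and> j' < j} \<union> {(i, j') \<in> P. Suc j \<le> i \<and> j' < t})" (is "?L = ?R")
    proof
      show "?L \<subseteq> ?R"
      proof (rule subsetI)
        fix x assume "x \<in> ?L"
        then obtain a b where ab: "x = (a, b)" "(a, b) \<in> P" "s \<le> a" "b < t"
          by auto
        consider "a = s \<or> a = j" | "s < a" "a < j" | "j < a"
          using ab(3) by linarith
        then show "x \<in> ?R"
          using disj[OF j(1) ab(2)] noncr[OF j(1) ab(2)] ab by cases auto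
      qed
      show "?R \<subseteq> ?L"
        using j by auto
    qed
    then show ?thesis
      using X G by (intro exI[of _ "Node X # G"]) auto
  qed
qed

lemma nc_matchings_edge:
  assumes "M \<in> nc_matchings n" "e \<in> M"
  shows "e \<subseteq> circle_points n" "card e = 2"
proof -
  have "\<forall>e\<in>M. e \<subseteq> circle_points n \<and> card e = 2"
    using assms(1) unfolding nc_matchings_def mem_Collect_eq by (elim conjE)
  then show "e \<subseteq> circle_points n" "card e = 2"
    using assms(2) by simp_all
qed

lemma nc_matchings_ex1:
  assumes "M \<in> nc_matchings n" "p \<in> circle_points n"
  shows "\<exists>!e. e \<in> M \<and> p \<in> e"
proof -
  have "\<forall>p\<in>circle_points n. \<exists>!e. e \<in> M \<and> p \<in> e"
    using assms(1) unfolding nc_matchings_def mem_Collect_eq by (elim conjE)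
  then show ?thesis
    using assms(2) by (rule bspec)
qed

lemma nc_matchings_cover:
  assumes "M \<in> nc_matchings n" "p \<in> circle_points n"
  shows "\<exists>e\<in>M. p \<in> e"
  using nc_matchings_ex1[OF assms] by (elim ex1E conjE) (rule bexI)

lemma nc_matchings_unique:
  assumes "M \<in> nc_matchings n" "e \<in> M" "f \<in> M" "p \<in> e" "p \<in> f"
  shows "e = f"
proof -
  have "p \<in> circle_points n"
    using nc_matchings_edge(1)[OF assms(1,2)] assms(4) by (rule subsetD)
  from nc_matchings_ex1[OF assms(1) this] show ?thesis
    using assms(2-5) by (elim ex1E) metis
qed

lemma nc_matchings_disjoint:
  assumes "M \<in> nc_matchings n" "e \<in> M" "f \<in> M" "e \<noteq> f"
  shows "convex hull e \<inter> convex hull f = {}"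
proof -
  have "\<forall>e\<in>M. \<forall>f\<in>M. e \<noteq> f \<longrightarrow> convex hull e \<inter> convex hull f = {}"
    using assms(1) unfolding nc_matchings_def mem_Collect_eq by (elim conjE)
  then show ?thesis
    using assms(2-4) by simp
qed

text \<open>Each edge is encoded by its increasing pair of indices below \<open>2 * n\<close>.
  Interleaving pairs would give intersecting segments by \<open>chords_cross\<close>, so the pairs
  form a bracket structure.\<close>

lemma nc_matching_eq_matching:
  assumes n: "n > 0" and M: "M \<in> nc_matchings n"
  obtains F where "nedges F = n" "M = matching n 0 F"
proof -
  note edge = nc_matchings_edge[OF M] and uniq = nc_matchings_unique[OF M]
    and ex = nc_matchings_cover[OF M] and nc = nc_matchings_disjoint[OF M]
  have inj: "pt n i = pt n j \<longleftrightarrow> i = j" if "i < 2 * n" "j < 2 * n" for i j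
    by (rule pt_eq_iff[of n 0]) (use n that in simp_all)
  define P where "P = {(i, j). i < j \<and> j < 2 * n \<and> {pt n i, pt n j} \<in> M}"
  have P: "i < j" "j < 2 * n" "{pt n i, pt n j} \<in> M" if "(i, j) \<in> P" for i j
    using that by (simp_all add: P_def)
  have ordered: "\<exists>i j. (i, j) \<in> P \<and> e = {pt n i, pt n j}" if e: "e \<in> M" for e
  proof -
    obtain x y where xy: "e = {x, y}" "x \<noteq> y"
      using edge(2)[OF e] unfolding card_2_iff by blast
    then have "x \<in> pt n ` {..<2 * n}" "y \<in> pt n ` {..<2 * n}"
      using edge(1)[OF e] by (simp_all add: circle_points_eq_pt)
    then obtain i j where ij: "x = pt n i" "y = pt n j" "i < 2 * n" "j < 2 * n"
      by (elim imageE) simp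
    show ?thesis
    proof (cases i j rule: linorder_cases)
      case less
      then show ?thesis
        using xy ij e by (intro exI[of _ i] exI[of _ j]) (simp add: P_def)
    next
      case equal
      then show ?thesis using xy ij by simp
    next
      case greater
      then show ?thesis
        using xy ij e by (intro exI[of _ j] exI[of _ i]) (simp add: P_def insert_commute)
    qed
  qed
  have pair_eq: "(i, j) = (k, l)"
    if "(i, j) \<in> P" "(k, l) \<in> P" "{pt n i, pt n j} = {pt n k, pt n l}" for i j k l
    using P[OF that(1)] P[OF that(2)] that(3) inj[of i k] inj[of i l] inj[of j k] inj[of j l]
    by (simp add: doubleton_eq_iff) linarith
  have "\<exists>F. 2 * n = 0 + 2 * nedges F \<and> {(i, j) \<in> P. 0 \<le> i \<and> j < 2 * n} = pairs 0 F"
  proof (rule noncrossing_pairs_eq_forest_pairs)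
    fix i j k l assume ij: "(i, j) \<in> P" and kl: "(k, l) \<in> P"
    show *: "(i, j) = (k, l)" if "k = i \<or> k = j \<or> l = j"
    proof -
      obtain p where "p \<in> {pt n i, pt n j}" "p \<in> {pt n k, pt n l}"
        using \<open>k = i \<or> k = j \<or> l = j\<close> by blast
      from pair_eq[OF ij kl uniq[OF P(3)[OF ij] P(3)[OF kl] this]] show ?thesis .
    qed
    show "l < j" if ik: "i < k" and kj: "k < j"
    proof (rule ccontr)
      assume "\<not> l < j"
      with * ik have "j < l" by (cases "l = j") auto
      then obtain z where z: "z \<in> open_segment (pt n k) (pt n l)" "z \<in> convex hull {pt n i, pt n j}"
        using chords_cross[of n i k j l] ik kj P[OF kl] n by auto
      have "z \<in> convex hull {pt n k, pt n l}"
        using z(1) by (simp add: open_segment_def segment_convex_hull)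
      moreover have "{pt n i, pt n j} \<noteq> {pt n k, pt n l}"
        using pair_eq[OF ij kl] ik by auto
      ultimately show False
        using nc[OF P(3)[OF ij] P(3)[OF kl]] z(2) by blast
    qed
  next
    fix k assume k: "k < 2 * n"
    then have "pt n k \<in> circle_points n"
      by (simp add: circle_points_eq_pt)
    then obtain e where e: "e \<in> M" "pt n k \<in> e"
      using ex by blast
    obtain i j where ij: "(i, j) \<in> P" "e = {pt n i, pt n j}"
      using ordered[OF e(1)] by blast
    have "k = i \<or> k = j"
      using e(2) k P[OF ij(1)] inj[of k i] inj[of k j] by (simp add: ij(2))
    then show "\<exists>i j. (i, j) \<in> P \<and> 0 \<le> i \<and> j < 2 * n \<and> (k = i \<or> k = j)"
      using ij(1) P[OF ij(1)] by blast
  qed (simp_all add: P(1))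
  then obtain F where F: "nedges F = n" "{(i, j) \<in> P. 0 \<le> i \<and> j < 2 * n} = pairs 0 F"
    by auto
  have "{(i, j) \<in> P. 0 \<le> i \<and> j < 2 * n} = P"
    using P(2) by auto
  moreover have "M = (\<lambda>(i, j). {pt n i, pt n j}) ` P"
  proof
    show "M \<subseteq> (\<lambda>(i, j). {pt n i, pt n j}) ` P"
    proof
      fix e assume "e \<in> M"
      then obtain i j where "(i, j) \<in> P" "e = {pt n i, pt n j}"
        using ordered by blast
      then show "e \<in> (\<lambda>(i, j). {pt n i, pt n j}) ` P"
        by (intro image_eqI[of _ _ "(i, j)"]) simp_all
    qed
  qed (use P(3) in auto)
  ultimately show thesis
    using F that by (simp add: matching_def)
qed

section \<open>Centered flips of forests\<close>

text \<open>Each edge in \<open>R\<close> stays within an open arc between consecutive vertices, so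
  the side spanning that arc separates it from the quadrilateral. The gap bounds place the centre
  inside.\<close>

lemma centered_flip_quad:
  assumes n: "n > 0" and ord: "a < b" "b < c" "c < d" "d < a + 2 * n"
    and gaps: "b \<le> a + n" "c \<le> b + n" "d \<le> c + n" "a + n \<le> d"
    and R: "\<And>g. g \<in> R \<Longrightarrow> \<exists>i j x y. g = {pt n i, pt n j} \<and> x < i \<and> i < y \<and> x < j \<and> j < y \<and>
      (x, y) \<in> {(a, b), (b, c), (c, d), (d, a + 2 * n)}"
  shows "centered_flip (insert {pt n a, pt n b} (insert {pt n c, pt n d} R))
    (insert {pt n b, pt n c} (insert {pt n d, pt n a} R))"
proof -
  let ?A = "pt n a" and ?B = "pt n b" and ?C = "pt n c" and ?D = "pt n d"
  let ?Q = "{?A, ?B, ?C, ?D}"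
  let ?M = "insert {?A, ?B} (insert {?C, ?D} R)"
  have Q: "{?A, ?B} \<union> {?C, ?D} = ?Q"
    by auto
  have dist: "?A \<noteq> ?B" "?A \<noteq> ?C" "?A \<noteq> ?D" "?B \<noteq> ?C" "?B \<noteq> ?D" "?C \<noteq> ?D"
    using assms by (auto simp: pt_eq_iff[of n a])
  have disj: "convex hull g \<inter> convex hull ?Q = {}" if "g \<in> R" for g
  proof -
    obtain i j x y where g: "g = {pt n i, pt n j}" and xy: "x < i" "i < y" "x < j" "j < y"
        "(x, y) \<in> {(a, b), (b, c), (c, d), (d, a + 2 * n)}"
      using R[OF \<open>g \<in> R\<close>] by blast
    \<comment> \<open>The four vertices, reindexed so that they run through the complementary arc
      from \<open>y\<close> to \<open>x + 2 * n\<close>.\<close>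
    define T where "T = (if x = a then {b, c, d, a + 2 * n}
      else if x = b then {c, d, a + 2 * n, b + 2 * n}
      else if x = c then {d, a + 2 * n, b + 2 * n, c + 2 * n}
      else {a + 2 * n, b + 2 * n, c + 2 * n, d + 2 * n})"
    have "pt n ` T = ?Q"
      using n by (auto simp: T_def)
    moreover have "convex hull (pt n ` {i, j}) \<inter> convex hull (pt n ` T) = {}"
      by (rule hulls_disjoint_of_arcs[of n x y]) (use n ord xy in \<open>auto simp: T_def split: if_splits\<close>)
    ultimately show ?thesis
      using g by simp
  qed
  have notin: "e \<notin> R" if "e \<subseteq> ?Q" "e \<noteq> {}" for e
  proof
    assume "e \<in> R"
    have "e \<subseteq> convex hull e" "e \<subseteq> convex hull ?Q"
      using that hull_subset[of e convex] hull_subset[of ?Q convex] by blast+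
    then show False
      using disj[OF \<open>e \<in> R\<close>] that(2) by blast
  qed
  have notR: "{?A, ?B} \<notin> R" "{?C, ?D} \<notin> R"
    by (rule notin; simp)+
  have neq: "{?A, ?B} \<noteq> {?C, ?D}"
    using dist by (simp add: doubleton_eq_iff)
  have "spans_empty_quad ?M {?A, ?B} {?C, ?D}"
    unfolding spans_empty_quad_def Q using neq disj by simp
  moreover have "quad_sides {?A, ?B} {?C, ?D} - {{?A, ?B}, {?C, ?D}} = {{?B, ?C}, {?D, ?A}}"
    unfolding quad_sides_pt[OF n ord] using dist by (simp add: insert_Diff_if doubleton_eq_iff)
  moreover have "?M - {{?A, ?B}, {?C, ?D}} = R"
    using notR by (simp add: insert_Diff_if)
  moreover have "0 \<in> convex hull ({?A, ?B} \<union> {?C, ?D})"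
    unfolding Q by (rule zero_in_quad[OF n ord gaps])
  ultimately show ?thesis
    unfolding centered_flip_def
    by (intro exI[of _ "{?A, ?B}"] exI[of _ "{?C, ?D}"]) simp
qed

text \<open>A side of the quadrilateral that cuts off \<open>k\<close> edges spans
  \<open>2 * k + 1\<close> steps. So the bound \<open>m\<close> says that no side spans more than
  \<open>2 * m + 1\<close> steps, half of the circle.\<close>

definition flip_rel :: "nat \<Rightarrow> complex set set rel" where
  "flip_rel m = {(matching (2 * m + 1) s (Node X # A @ Node Y # B),
      matching (2 * m + 1) (s + 1) (X @ Node A # Y @ [Node B])) | s X A Y B.
    nedges X \<le> m \<and> nedges A \<le> m \<and> nedges Y \<le> m \<and> nedges B \<le> m \<and>
    nedges X + nedges A + nedges Y + nedges B + 1 = 2 * m}"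

lemma flip_relI:
  assumes "nedges X \<le> m" "nedges A \<le> m" "nedges Y \<le> m" "nedges B \<le> m"
    "nedges X + nedges A + nedges Y + nedges B + 1 = 2 * m"
  shows "(matching (2 * m + 1) s (Node X # A @ Node Y # B),
      matching (2 * m + 1) (s + 1) (X @ Node A # Y @ [Node B])) \<in> flip_rel m"
  unfolding flip_rel_def using assms by blast

lemma flip_rel_imp_centered_flip:
  assumes "(M, M') \<in> flip_rel m"
  shows "M \<in> nc_matchings (2 * m + 1)" "M' \<in> nc_matchings (2 * m + 1)" "centered_flip M M'"
proof -
  obtain s X A Y B where
    M: "M = matching (2 * m + 1) s (Node X # A @ Node Y # B)" and
    M': "M' = matching (2 * m + 1) (s + 1) (X @ Node A # Y @ [Node B])" and
    le: "nedges X \<le> m" "nedges A \<le> m" "nedges Y \<le> m" "nedges B \<le> m" and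
    sum: "nedges X + nedges A + nedges Y + nedges B + 1 = 2 * m"
    using assms unfolding flip_rel_def by blast
  show "M \<in> nc_matchings (2 * m + 1)" "M' \<in> nc_matchings (2 * m + 1)"
    unfolding M M' using sum by (intro matching_in_nc_matchings; simp)+
  let ?n = "2 * m + 1"
  \<comment> \<open>The vertices of the quadrilateral are \<open>s\<close>, \<open>b\<close>,
    \<open>c\<close>, \<open>d\<close>; the forests \<open>X\<close>, \<open>A\<close>,
    \<open>Y\<close>, \<open>B\<close> occupy the four arcs in this order.\<close>
  define b where "b = s + 2 * nedges X + 1"
  define c where "c = b + 2 * nedges A + 1"
  define d where "d = c + 2 * nedges Y + 1"
  have d: "d + 2 * nedges B + 1 = s + 2 * ?n"
    using sum by (simp add: b_def c_def d_def)
  define R where "R = matching ?n (s + 1) X \<union> matching ?n (b + 1) A \<union> matching ?n (c + 1) Y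
    \<union> matching ?n (d + 1) B"
  have per: "pt ?n (s + 2 * ?n) = pt ?n s"
    by (rule pt_periodic) simp
  have 1: "M = insert {pt ?n s, pt ?n b} (insert {pt ?n c, pt ?n d} R)"
    unfolding M R_def matching_append matching_Cons
    by (simp add: b_def c_def d_def insert_commute Un_ac ac_simps)
  have 2: "M' = insert {pt ?n b, pt ?n c} (insert {pt ?n d, pt ?n s} R)"
    unfolding M' R_def matching_append matching_Cons per[symmetric] d[symmetric]
    by (simp add: b_def c_def d_def insert_commute Un_ac ac_simps)
  have in_arc: "\<exists>i j x y. g = {pt ?n i, pt ?n j} \<and> x < i \<and> i < y \<and> x < j \<and> j < y \<and> (x, y) \<in> P"
    if "g \<in> matching ?n (x + 1) Z" "x + 2 * nedges Z + 1 = y" "(x, y) \<in> P" for g x y Z P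
  proof -
    obtain i j where "(i, j) \<in> pairs (x + 1) Z" "g = {pt ?n i, pt ?n j}"
      using \<open>g \<in> matching ?n (x + 1) Z\<close> unfolding matching_iff by blast
    then show ?thesis
      using pairs_bounds[of i j "x + 1" Z] \<open>x + 2 * nedges Z + 1 = y\<close> \<open>(x, y) \<in> P\<close>
      by (intro exI[of _ i] exI[of _ j] exI[of _ x] exI[of _ y]) simp
  qed
  show "centered_flip M M'"
    unfolding 1 2
  proof (rule centered_flip_quad)
    show "\<exists>i j x y. g = {pt ?n i, pt ?n j} \<and> x < i \<and> i < y \<and> x < j \<and> j < y \<and>
        (x, y) \<in> {(s, b), (b, c), (c, d), (d, s + 2 * ?n)}" if "g \<in> R" for g
    proof -
      consider "g \<in> matching ?n (s + 1) X" | "g \<in> matching ?n (b + 1) A"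
        | "g \<in> matching ?n (c + 1) Y" | "g \<in> matching ?n (d + 1) B"
        using \<open>g \<in> R\<close> unfolding R_def by blast
      then show ?thesis
      proof cases
        case 1
        then show ?thesis by (rule in_arc[where y = "b"]) (simp_all add: b_def)
      next
        case 2
        then show ?thesis by (rule in_arc[where y = "c"]) (simp_all add: c_def)
      next
        case 3
        then show ?thesis by (rule in_arc[where y = "d"]) (simp_all add: d_def)
      next
        case 4
        then show ?thesis by (rule in_arc[where y = "s + 2 * ?n"]) (use d in simp_all)
      qed
    qed
  qed (use le sum in \<open>simp_all add: b_def c_def d_def\<close>)
qed

text \<open>Rotating \<open>X[A]Y[B]\<close> past \<open>X\<close> gives \<open>[A]Y[B]X\<close>,
  which has the form required for a flip. Its flip is \<open>A[Y]B[X]\<close>, a rotation of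
  \<open>[X]A[Y]B\<close>.\<close>

lemma flip_rel_sym:
  assumes "(M, M') \<in> flip_rel m"
  shows "(M', M) \<in> flip_rel m"
proof -
  obtain s X A Y B where
    M: "M = matching (2 * m + 1) s (Node X # A @ Node Y # B)" and
    M': "M' = matching (2 * m + 1) (s + 1) (X @ Node A # Y @ [Node B])" and
    le: "nedges X \<le> m" "nedges A \<le> m" "nedges Y \<le> m" "nedges B \<le> m" and
    sum: "nedges X + nedges A + nedges Y + nedges B + 1 = 2 * m"
    using assms unfolding flip_rel_def by blast
  have "M' = matching (2 * m + 1) (s + 1 + 2 * nedges X) (Node A # Y @ Node B # X)"
    unfolding M' using matching_rotate[of "2 * m + 1" X "Node A # Y @ [Node B]" "s + 1"] sum by simp
  moreover have "M = matching (2 * m + 1) (s + 1 + 2 * nedges X + 1) (A @ Node Y # B @ [Node X])"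
    unfolding M using matching_rotate[of "2 * m + 1" "[Node X]" "A @ Node Y # B" s] sum by simp
  ultimately show ?thesis
    using flip_relI[of A m Y B X "s + 1 + 2 * nedges X"] le sum by simp
qed

section \<open>Choosing a root face that contains the centre\<close>

text \<open>While some branch has more than \<open>m\<close> edges behind its edge, the root moves
  across that edge. What is left behind has fewer than \<open>m\<close> edges, and the forest
  \<open>X\<close> in front shrinks, so this ends.\<close>

lemma centered_forest_exists:
  assumes "nedges X + nedges R = 2 * m" "nedges R \<le> m"
  shows "\<exists>s' F. matching (2 * m + 1) s (X @ [Node R]) = matching (2 * m + 1) s' F \<and>
    nedges F = 2 * m + 1 \<and> (\<forall>Z. Node Z \<in> set F \<longrightarrow> nedges Z \<le> m)"
  using assms
proof (induction "nedges X" arbitrary: X R s rule: less_induct)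
  case less
  show ?case
  proof (cases "\<forall>Z. Node Z \<in> set X \<longrightarrow> nedges Z \<le> m")
    case True
    then show ?thesis
      using less.prems by (intro exI[of _ s] exI[of _ "X @ [Node R]"]) auto
  next
    case False
    then obtain Z where Z: "Node Z \<in> set X" "m < nedges Z"
      by auto
    then obtain X1 X2 where X: "X = X1 @ Node Z # X2"
      by (meson split_list)
    let ?R' = "X2 @ Node R # X1"
    have "matching (2 * m + 1) s (X @ [Node R])
        = matching (2 * m + 1) (s + 2 * nedges X1) (Node Z # ?R')"
      using matching_rotate[of "2 * m + 1" X1 "Node Z # X2 @ [Node R]" s] less.prems X by simp
    also have "\<dots> = matching (2 * m + 1) (s + 2 * nedges X1 + 1) (Z @ [Node ?R'])"
      using less.prems X by (intro matching_reroot) simp_all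
    finally have "matching (2 * m + 1) s (X @ [Node R]) = \<dots>" .
    moreover have "nedges Z < nedges X" "nedges Z + nedges ?R' = 2 * m" "nedges ?R' \<le> m"
      using less.prems X Z(2) by simp_all
    ultimately show ?thesis
      using less.hyps[of Z ?R' "s + 2 * nedges X1 + 1"] by simp
  qed
qed

lemma nc_matching_eq_centered_matching:
  assumes "M \<in> nc_matchings (2 * m + 1)"
  obtains s F where "M = matching (2 * m + 1) s F" "nedges F = 2 * m + 1"
    "\<forall>Z. Node Z \<in> set F \<longrightarrow> nedges Z \<le> m"
proof -
  let ?n = "2 * m + 1"
  obtain F where F: "nedges F = ?n" "M = matching ?n 0 F"
    using nc_matching_eq_matching[OF _ assms] by auto
  then obtain X R where XR: "F = Node X # R"
    by (cases F rule: nedges.cases) auto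
  have "\<exists>s X' R'. M = matching ?n s (X' @ [Node R']) \<and> nedges X' + nedges R' = 2 * m \<and> nedges R' \<le> m"
  \<comment> \<open>The first edge has \<open>2 * m\<close> other edges on its two sides together; a
    side with at most \<open>m\<close> of them becomes the last branch.\<close>
  proof (cases "nedges R \<le> m")
    case True
    have "M = matching ?n 1 (X @ [Node R])"
      using matching_reroot[of ?n X R 0] F XR by simp
    then show ?thesis
      using True F XR by (intro exI[of _ 1] exI[of _ X] exI[of _ R]) simp
  next
    case False
    have "M = matching ?n (2 * nedges X + 2) (R @ [Node X])"
      using matching_rotate[of ?n "[Node X]" R 0] F XR by simp
    then show ?thesis
      using False F XR by (intro exI[of _ "2 * nedges X + 2"] exI[of _ R] exI[of _ X]) simp
  qed
  then obtain s X' R' where "M = matching ?n s (X' @ [Node R'])" "nedges X' + nedges R' = 2 * m" "nedges R' \<le> m"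
    by blast
  then show thesis
    using centered_forest_exists[of X' R' m s] that by metis
qed

section \<open>Reaching the star\<close>

text \<open>With the reflexive closure, \<open>k\<close> is only an upper bound on the number of
  flips.\<close>

definition flips :: "nat \<Rightarrow> nat \<Rightarrow> complex set set rel" where
  "flips m k = ((flip_rel m)\<^sup>=) ^^ k"

lemma flips_refl [simp]: "(M, M) \<in> flips m k"
  by (induction k) (auto simp: flips_def)

lemma flips_trans: "(L, M) \<in> flips m i \<Longrightarrow> (M, N) \<in> flips m j \<Longrightarrow> (L, N) \<in> flips m (i + j)"
  by (auto simp: flips_def relpow_add)

lemma flips_mono:
  assumes "(M, N) \<in> flips m i" "i \<le> j"
  shows "(M, N) \<in> flips m j"
  using flips_trans[OF assms(1) flips_refl, of "j - i"] assms(2) by simp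

lemma flips_1: "(M, N) \<in> flip_rel m \<Longrightarrow> (M, N) \<in> flips m 1"
  by (simp add: flips_def)

lemma flips_sym: "(M, N) \<in> flips m k \<Longrightarrow> (N, M) \<in> flips m k"
proof (induction k arbitrary: M N)
  case (Suc k)
  then obtain L where "(M, L) \<in> flips m k" "(L, N) \<in> (flip_rel m)\<^sup>="
    by (auto simp: flips_def)
  then have "(L, M) \<in> flips m k" "(N, L) \<in> flips m 1"
    using Suc.IH flip_rel_sym by (auto simp: flips_def)
  then show ?case
    using flips_trans[of N L m 1 M k] by simp
qed (simp add: flips_def)

section \<open>Flipping towards a diameter\<close>

text \<open>Greedy choice: branches are added to \<open>P\<close> as long as the total stays at most
  \<open>m\<close>. The first one that does not fit, \<open>[Y]\<close>, has
  \<open>nedges Y + 1\<close> edges, which yields the last bound.\<close>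

lemma split_at_weight:
  assumes "nedges P \<le> m" "m < nedges P + nedges R"
  obtains A Y B where "R = A @ Node Y # B" "nedges P + nedges A \<le> m" "m \<le> nedges P + nedges A + nedges Y"
proof -
  have "\<exists>A Y B. R = A @ Node Y # B \<and> nedges P + nedges A \<le> m \<and> m \<le> nedges P + nedges A + nedges Y"
    using assms
  proof (induction R arbitrary: P rule: nedges.induct)
    case (2 Y R)
    show ?case
    proof (cases "nedges (P @ [Node Y]) \<le> m")
      case True
      then obtain A Z B where "R = A @ Node Z # B" "nedges (P @ [Node Y]) + nedges A \<le> m"
          "m \<le> nedges (P @ [Node Y]) + nedges A + nedges Z"
        using "2.IH"(2)[of "P @ [Node Y]"] "2.prems" by auto
      then show ?thesis
        by (intro exI[of _ "Node Y # A"] exI[of _ Z] exI[of _ B]) simp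
    next
      case False
      then show ?thesis
        using "2.prems" by (intro exI[of _ "[]"] exI[of _ Y] exI[of _ R]) simp
    qed
  qed simp
  then show thesis
    using that by blast
qed

lemma last_branch:
  assumes "F \<noteq> []"
  obtains A Y where "F = A @ [Node Y]"
  using assms by (metis append_butlast_last_id ptree.exhaust)

text \<open>If \<open>A\<close> is a maximal run of consecutive branches starting with \<open>[Z]\<close> and having at most \<open>m\<close>
  edges, then flipping the two branches next to \<open>A\<close> creates the branch \<open>[A]\<close>, which is larger than
  \<open>[Z]\<close>. A branch \<open>[Z]\<close> with \<open>nedges Z = m\<close> is a diameter.\<close>

lemma reach_diameter:
  assumes "nedges F = 2 * m + 1" "\<And>Z. Node Z \<in> set F \<Longrightarrow> nedges Z \<le> m" "Node Z \<in> set F"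
  shows "\<exists>s' A B. nedges A = m \<and> nedges B = m \<and>
    (matching (2 * m + 1) s F, matching (2 * m + 1) s' (A @ [Node B])) \<in> flips m (m - nedges Z)"
  using assms
proof (induction "m - nedges Z" arbitrary: F Z s rule: less_induct)
  case less
  let ?n = "2 * m + 1"
  have rot: "matching ?n s F = matching ?n (s + 2 * nedges F1) (Node Y # F2 @ F1)"
    if "F = F1 @ Node Y # F2" for F1 Y F2
    using matching_rotate[of ?n F1 "Node Y # F2" s] that less.prems(1) by simp
  show ?case
  proof (cases "\<exists>Y. Node Y \<in> set F \<and> nedges Y = m")
    case True
    then obtain Y F1 F2 where Y: "nedges Y = m" "F = F1 @ Node Y # F2"
      by (metis split_list)
    let ?t = "s + 2 * nedges F1 + 2 * (m + 1)"
    have "matching ?n s F = matching ?n ?t ((F2 @ F1) @ [Node Y])"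
      using rot[OF Y(2)] matching_rotate[of ?n "[Node Y]" "F2 @ F1" "s + 2 * nedges F1"]
        Y less.prems(1) by simp
    then show ?thesis
      using Y less.prems(1) by (intro exI[of _ ?t] exI[of _ "F2 @ F1"] exI[of _ Y]) simp
  next
    case False
    then have small: "nedges Y < m" if "Node Y \<in> set F" for Y
      using less.prems(2)[OF that] that by (auto simp: order.strict_iff_order)
    obtain F1 F2 where F: "F = F1 @ Node Z # F2"
      using less.prems(3) by (meson split_list)
    have Zm: "nedges Z < m"
      using small less.prems(3) .
    obtain A Y C where C: "F2 @ F1 = A @ Node Y # C" "nedges [Node Z] + nedges A \<le> m"
        "m \<le> nedges [Node Z] + nedges A + nedges Y"
      using split_at_weight[of "[Node Z]" m "F2 @ F1"] Zm less.prems(1) F by auto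
    have setF: "set F = insert (Node Z) (set (A @ Node Y # C))"
      unfolding C(1)[symmetric] F by auto
    have total: "nedges Z + nedges A + nedges Y + nedges C + 2 = ?n"
      using arg_cong[OF C(1), of nedges] less.prems(1) F by simp
    have Ym: "nedges Y < m"
      using small setF by simp
    \<comment> \<open>The run \<open>[Z]A\<close> has at most \<open>m\<close> edges and
      \<open>[Y]\<close> at most \<open>m\<close>, together fewer than
      \<open>2 * m + 1\<close>.\<close>
    then have "C \<noteq> []"
      using total C(2) by auto
    \<comment> \<open>In cyclic order \<open>[X]\<close> directly precedes \<open>[Z]\<close>, so
      flipping \<open>[X]\<close> and \<open>[Y]\<close> encloses exactly the run
      \<open>[Z]A\<close>.\<close>
    then obtain B X where B: "C = B @ [Node X]"
      by (rule last_branch)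
    have Xm: "nedges X < m"
      using small setF B by simp
    let ?A = "Node Z # A"
    let ?t = "s + 2 * nedges F1 + 2 * nedges (?A @ Node Y # B)"
    let ?G = "X @ Node ?A # Y @ [Node B]"
    have "matching ?n s F = matching ?n ?t (Node X # ?A @ Node Y # B)"
      using rot[OF F] matching_rotate[of ?n "?A @ Node Y # B" "[Node X]" "s + 2 * nedges F1"]
        C(1) B total by simp
    then have step: "(matching ?n s F, matching ?n (?t + 1) ?G) \<in> flips m 1"
      using flip_relI[of X m ?A Y B ?t] Xm Ym C total B by (intro flips_1) simp
    have sub: "nedges W < nedges V" if "Node W \<in> set V" for W V
      using split_list[OF that] by auto
    have "\<exists>s' A' B'. nedges A' = m \<and> nedges B' = m \<and>
        (matching ?n (?t + 1) ?G, matching ?n s' (A' @ [Node B'])) \<in> flips m (m - nedges ?A)"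
    proof (rule less.hyps)
      show "m - nedges ?A < m - nedges Z"
        using Zm by simp
      show "nedges ?G = ?n"
        using total B by simp
      show "nedges W \<le> m" if "Node W \<in> set ?G" for W
        using that sub[of W X] sub[of W Y] Xm Ym C total B by auto
    qed simp
    then obtain s' A' B' where res: "nedges A' = m" "nedges B' = m"
        "(matching ?n (?t + 1) ?G, matching ?n s' (A' @ [Node B'])) \<in> flips m (m - nedges ?A)"
      by blast
    have "1 + (m - nedges ?A) \<le> m - nedges Z"
      using Zm C(2) by simp
    with flips_trans[OF step res(3)]
    have "(matching ?n s F, matching ?n s' (A' @ [Node B'])) \<in> flips m (m - nedges Z)"
      by (rule flips_mono)
    then show ?thesis
      using res by blast
  qed
qed

section \<open>From a diameter to the star\<close>

text \<open>The root crosses the diameter \<open>[B]\<close>, which exchanges its two sides. The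
  start moves by the odd number \<open>2 * m + 1\<close>, so its parity can be chosen.\<close>

lemma diameter_switch:
  assumes "nedges A = m" "nedges B = m"
  shows "matching (2 * m + 1) s (A @ [Node B]) = matching (2 * m + 1) (s + 2 * m + 1) (B @ [Node A])"
proof -
  have "matching (2 * m + 1) s (A @ [Node B]) = matching (2 * m + 1) (s + 2 * m) (Node B # A)"
    using matching_rotate[of "2 * m + 1" A "[Node B]" s] assms by simp
  also have "\<dots> = matching (2 * m + 1) (s + 2 * m + 1) (B @ [Node A])"
    using assms by (intro matching_reroot) simp_all
  finally show ?thesis .
qed

text \<open>Flips the diameter \<open>[B]\<close> with its cyclic neighbour: \<open>[B]A[Y]\<close>
  becomes \<open>B[A]Y[]\<close>. The empty fourth part turns into a leaf between two halves of
  \<open>m\<close> edges each.\<close>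

lemma diameter_flip:
  assumes "nedges A + nedges Y + 1 = m" "nedges B = m"
  shows "(matching (2 * m + 1) s (A @ [Node Y, Node B]),
    matching (2 * m + 1) (s + 4 * m + 1) ((Node A # Y) @ Node [] # B)) \<in> flips m 1"
proof -
  have A: "nedges (A @ [Node Y]) = m"
    using assms by simp
  have "matching (2 * m + 1) s (A @ [Node Y, Node B]) = matching (2 * m + 1) (s + 2 * m) (Node B # A @ Node Y # [])"
    using matching_rotate[of "2 * m + 1" "A @ [Node Y]" "[Node B]" s, unfolded A] assms by simp
  moreover have "matching (2 * m + 1) (s + 2 * m + 1) (B @ Node A # Y @ [Node []])
      = matching (2 * m + 1) (s + 4 * m + 1) ((Node A # Y) @ Node [] # B)"
    using matching_rotate[of "2 * m + 1" B "Node A # Y @ [Node []]" "s + 2 * m + 1"] assms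
    by (simp add: algebra_simps)
  moreover have "(matching (2 * m + 1) (s + 2 * m) (Node B # A @ Node Y # []),
      matching (2 * m + 1) (s + 2 * m + 1) (B @ Node A # Y @ [Node []])) \<in> flip_rel m"
    using assms by (intro flip_relI) simp_all
  ultimately show ?thesis
    by (intro flips_1) simp
qed

text \<open>With \<open>B' = B[]\<close> the three flips are \<open>[[Q]Y]B'[X]D\<close> to
  \<open>[Q]Y[B']X[D]\<close> to \<open>Q[Y]B'[X[D]]\<close>, whose last branch is a diameter, and,
  seen from its other side, \<open>X[D][Q[Y]B']\<close> to \<open>[X]D[]Q[Y]B'\<close>. The start
  moves by \<open>8 * m + 4\<close> in total, an even number.\<close>

lemma promote_first_grandchild:
  assumes "nedges (Node (Node Q # Y) # B) = m" "nedges (Node X # D) = m"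
  shows "\<exists>s'. even s' = even s \<and>
    (matching (2 * m + 1) s ((Node (Node Q # Y) # B) @ Node [] # Node X # D),
     matching (2 * m + 1) s' ((Node [] # Q @ Node Y # B) @ Node [] # Node X # D)) \<in> flips m 3"
proof -
  let ?n = "2 * m + 1" and ?B = "B @ [Node []]"
  let ?A = "Q @ Node Y # ?B"
  have "(matching ?n s (Node (Node Q # Y) # ?B @ Node X # D),
      matching ?n (s + 1) ((Node Q # Y) @ Node ?B # X @ [Node D])) \<in> flips m 1"
    using assms by (intro flips_1 flip_relI) simp_all
  moreover have "(matching ?n (s + 1) (Node Q # Y @ Node ?B # (X @ [Node D])),
      matching ?n (s + 1 + 1) (Q @ Node Y # ?B @ [Node (X @ [Node D])])) \<in> flips m 1"
    using assms by (intro flips_1 flip_relI) simp_all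
  moreover have "matching ?n (s + 1 + 1) (?A @ [Node (X @ [Node D])])
      = matching ?n (s + 1 + 1 + 2 * m + 1) ((X @ [Node D]) @ [Node ?A])"
    using assms by (intro diameter_switch) simp_all
  moreover have "(matching ?n (s + 1 + 1 + 2 * m + 1) (X @ [Node D, Node ?A]),
      matching ?n (s + 1 + 1 + 2 * m + 1 + 4 * m + 1) ((Node X # D) @ Node [] # ?A)) \<in> flips m 1"
    using assms by (intro diameter_flip) simp_all
  moreover have "matching ?n (s + 1 + 1 + 2 * m + 1 + 4 * m + 1) ((Node X # D) @ Node [] # ?A)
      = matching ?n (s + 1 + 1 + 2 * m + 1 + 4 * m + 1 + 2 * m) ((Node [] # ?A) @ Node X # D)"
    using matching_rotate[of ?n "Node X # D" "Node [] # ?A" "s + 1 + 1 + 2 * m + 1 + 4 * m + 1",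
        unfolded assms(2)] assms
    by simp
  ultimately have "(matching ?n s ((Node (Node Q # Y) # B) @ Node [] # Node X # D),
     matching ?n (s + 1 + 1 + 2 * m + 1 + 4 * m + 1 + 2 * m) ((Node [] # Q @ Node Y # B) @ Node [] # Node X # D))
      \<in> flips m (1 + 1 + 1)"
    using flips_trans by (metis append.assoc append_Cons append_Nil)
  then show ?thesis
    by (intro exI[of _ "s + 1 + 1 + 2 * m + 1 + 4 * m + 1 + 2 * m"]) (simp add: numeral_3_eq_3)
qed

text \<open>The leading leaf becomes the separator of the halves, and the old separator joins the
  new second half. The start keeps its parity.\<close>

lemma leaf_rotate:
  assumes "nedges (Node [] # B) = m" "nedges G = m"
  shows "matching (2 * m + 1) s ((Node [] # B) @ Node [] # G)
    = matching (2 * m + 1) (s + 2 * (m + 1)) (G @ Node [] # B @ [Node []])"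
  using matching_rotate[of "2 * m + 1" "Node [] # B @ [Node []]" G s] assms by simp

lemma length_le_nedges: "length F \<le> nedges F"
  by (induction F rule: nedges.induct) auto

lemma nedges_eq_length_iff: "nedges F = length F \<longleftrightarrow> F = replicate (length F) (Node [])"
proof (induction F rule: nedges.induct)
  case (2 X F)
  have "nedges X + nedges F = length F \<longleftrightarrow> X = [] \<and> nedges F = length F"
    using length_le_nedges[of X] length_le_nedges[of F] by (cases X) auto
  then show ?case using 2 by simp
qed simp

lemma nonleaf_exists:
  assumes "length F < nedges F"
  obtains j Q Y B where "F = replicate j (Node []) @ Node (Node Q # Y) # B"
proof -
  have "\<exists>j Q Y B. F = replicate j (Node []) @ Node (Node Q # Y) # B"
    using assms
  proof (induction F)
    case (Cons T F)
    obtain X where T: "T = Node X" by (cases T)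
    show ?case
    proof (cases X rule: nedges.cases)
      case 1
      then obtain j Q Y B where "F = replicate j (Node []) @ Node (Node Q # Y) # B"
        using Cons T by auto
      then show ?thesis
        using 1 T by (intro exI[of _ "Suc j"] exI[of _ Q] exI[of _ Y] exI[of _ B]) simp
    next
      case (2 Q Y)
      then show ?thesis
        using T by (intro exI[of _ 0] exI[of _ Q] exI[of _ Y] exI[of _ F]) simp
    qed
  qed simp
  then show thesis using that by blast
qed

text \<open>One \<open>leaf_rotate\<close> brings \<open>G\<close> to the front. If \<open>G\<close>
  starts with a non-leaf, this suffices; otherwise a second one brings back the first half with one
  leading leaf fewer.\<close>

lemma rotate_nonleaf_to_front:
  assumes "nedges (replicate j (Node []) @ Node (Node Q # Y) # B) = m" "nedges G = m"
  shows "\<exists>s' Q' Y' B' G'. even s' = even s \<and>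
    matching (2 * m + 1) s ((replicate j (Node []) @ Node (Node Q # Y) # B) @ Node [] # G)
      = matching (2 * m + 1) s' ((Node (Node Q' # Y') # B') @ Node [] # G') \<and>
    nedges (Node (Node Q' # Y') # B') = m \<and> nedges G' = m \<and>
    Suc (length B' + length G') = Suc (j + length B + length G)"
  using assms
proof (induction j arbitrary: s B G)
  case 0
  then show ?case
    by (intro exI[of _ s] exI[of _ Q] exI[of _ Y] exI[of _ B] exI[of _ G]) simp
next
  case (Suc j)
  let ?n = "2 * m + 1" and ?F = "replicate j (Node []) @ Node (Node Q # Y) # B"
  have 1: "matching ?n s ((Node [] # ?F) @ Node [] # G)
      = matching ?n (s + 2 * (m + 1)) (G @ Node [] # ?F @ [Node []])"
    using Suc.prems by (intro leaf_rotate) simp_all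
  show ?case
  proof (cases G rule: nedges.cases)
    case 1
    then show ?thesis using Suc.prems by simp
  next
    case G: (2 Z G')
    show ?thesis
    proof (cases Z rule: nedges.cases)
      case Z: 1
      have "matching ?n (s + 2 * (m + 1)) ((Node [] # G') @ Node [] # ?F @ [Node []])
          = matching ?n (s + 2 * (m + 1) + 2 * (m + 1)) ((?F @ [Node []]) @ Node [] # G' @ [Node []])"
        using Suc.prems G Z by (intro leaf_rotate) simp_all
      moreover have "nedges (replicate j (Node []) @ Node (Node Q # Y) # (B @ [Node []])) = m"
          "nedges (G' @ [Node []]) = m"
        using Suc.prems G Z by simp_all
      note Suc.IH[OF this, of "s + 2 * (m + 1) + 2 * (m + 1)"]
      ultimately show ?thesis
        using 1 G Z by simp
    next
      case Z: (2 Q' Y')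
      then show ?thesis
        using 1 G Suc.prems
        by (intro exI[of _ "s + 2 * (m + 1)"] exI[of _ Q'] exI[of _ Y'] exI[of _ G']
            exI[of _ "?F @ [Node []]"]) simp
    qed
  qed
qed

text \<open>If the first half consists of leaves only, the second has a non-leaf, and a single
  rotation exchanges the two halves.\<close>

lemma nonstar_nonleaf_to_front:
  assumes "nedges B = m" "nedges G = m" "length B + length G < 2 * m"
  shows "\<exists>s' Q Y B' G'. even s' = even s \<and>
    matching (2 * m + 1) s (B @ Node [] # G)
      = matching (2 * m + 1) s' ((Node (Node Q # Y) # B') @ Node [] # G') \<and>
    nedges (Node (Node Q # Y) # B') = m \<and> nedges G' = m \<and>
    Suc (length B' + length G') = length B + length G"
proof (cases "length B < nedges B")
  case True
  then obtain j Q Y B1 where "B = replicate j (Node []) @ Node (Node Q # Y) # B1"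
    by (rule nonleaf_exists)
  then show ?thesis
    using rotate_nonleaf_to_front[of j Q Y B1 m G s] assms by simp
next
  case False
  have "length G < nedges G"
    using assms length_le_nedges[of B] False by linarith
  then obtain j Q Y G1 where G: "G = replicate j (Node []) @ Node (Node Q # Y) # G1"
    by (rule nonleaf_exists)
  have "nedges B = length B"
    using False length_le_nedges[of B] by simp
  then have B: "B = replicate m (Node [])"
    using assms(1) nedges_eq_length_iff[of B] by simp
  moreover have "m > 0"
    using assms by simp
  ultimately obtain k where k: "m = Suc k" "B = Node [] # replicate k (Node [])"
    by (cases m) auto
  then have "B = replicate k (Node []) @ [Node []]"
    by (simp add: replicate_append_same)
  then have "matching (2 * m + 1) s (B @ Node [] # G) = matching (2 * m + 1) (s + 2 * (m + 1)) (G @ Node [] # B)"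
    using leaf_rotate[of "replicate k (Node [])" m G s] k assms by simp
  then show ?thesis
    using rotate_nonleaf_to_front[of j Q Y G1 m B "s + 2 * (m + 1)"] G assms by (simp add: add.commute)
qed

text \<open>Each promotion costs three flips and adds at least one branch at the root face, where
  the two halves have at most \<open>2 * m\<close>. The even start is carried along to identify the
  final star.\<close>

lemma reach_star:
  assumes "nedges B = m" "nedges G = m" "even s"
  shows "\<exists>s'. even s' \<and> (matching (2 * m + 1) s (B @ Node [] # G),
    matching (2 * m + 1) s' (replicate (2 * m + 1) (Node []))) \<in> flips m (3 * (2 * m - (length B + length G)))"
  using assms
proof (induction "2 * m - (length B + length G)" arbitrary: B G s rule: less_induct)
  case less
  let ?n = "2 * m + 1"
  have le: "length B \<le> m" "length G \<le> m"
    using length_le_nedges[of B] length_le_nedges[of G] less.prems by auto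
  show ?case
  proof (cases "length B + length G < 2 * m")
    case False
    then have "nedges B = length B" "nedges G = length G"
      using le less.prems by auto
    \<comment> \<open>As many branches as edges forces every branch to be a leaf.\<close>
    then have B: "B = replicate m (Node [])" and G: "G = replicate m (Node [])"
      using nedges_eq_length_iff[of B] nedges_eq_length_iff[of G] less.prems by auto
    have "2 * m + 1 = m + Suc m" by simp
    then have "replicate (2 * m + 1) (Node []) = B @ Node [] # G"
      by (simp only: B G replicate_add replicate_Suc)
    then show ?thesis
      using less.prems by (intro exI[of _ s]) simp
  next
    case True
    then obtain s1 Q Y B' G' where 1: "even s1 = even s"
      "matching ?n s (B @ Node [] # G) = matching ?n s1 ((Node (Node Q # Y) # B') @ Node [] # G')"
      "nedges (Node (Node Q # Y) # B') = m" "nedges G' = m"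
      "Suc (length B' + length G') = length B + length G"
      using nonstar_nonleaf_to_front[of B m G s] less.prems by blast
    have "m > 0" using 1(3) by auto
    then obtain X D where G': "G' = Node X # D"
      using 1(4) by (cases G' rule: nedges.cases) auto
    let ?B2 = "Node [] # Q @ Node Y # B'"
    obtain s2 where 2: "even s2 = even s1"
      "(matching ?n s1 ((Node (Node Q # Y) # B') @ Node [] # G'), matching ?n s2 (?B2 @ Node [] # G')) \<in> flips m 3"
      using promote_first_grandchild[of Q Y B' m X D s1] 1 G' by auto
    have B2: "nedges ?B2 = m" "length B + length G < length ?B2 + length G'"
      using 1 by auto
    have "\<exists>s'. even s' \<and> (matching ?n s2 (?B2 @ Node [] # G'),
        matching ?n s' (replicate ?n (Node []))) \<in> flips m (3 * (2 * m - (length ?B2 + length G')))"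
      by (rule less.hyps) (use True 1 2 B2 less.prems in auto)
    then obtain s' where 3: "even s'" "(matching ?n s2 (?B2 @ Node [] # G'),
        matching ?n s' (replicate ?n (Node []))) \<in> flips m (3 * (2 * m - (length ?B2 + length G')))"
      by blast
    have "3 + 3 * (2 * m - (length ?B2 + length G')) \<le> 3 * (2 * m - (length B + length G))"
      using B2 True by linarith
    with flips_trans[OF 2(2) 3(2)] have "(matching ?n s (B @ Node [] # G),
        matching ?n s' (replicate ?n (Node []))) \<in> flips m (3 * (2 * m - (length B + length G)))"
      unfolding 1(2) by (rule flips_mono)
    then show ?thesis
      using 3(1) by blast
  qed
qed

text \<open>Rotating the star past one leaf moves its start by two.\<close>

lemma matching_star_even:
  assumes "even s"
  shows "matching n s (replicate n (Node [])) = matching n 0 (replicate n (Node []))"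
proof -
  have "matching n (2 * k) (replicate n (Node [])) = matching n 0 (replicate n (Node []))" for k
  proof (induction k)
    case (Suc k)
    show ?case
    proof (cases n)
      case n: (Suc l)
      show ?thesis
        using matching_rotate[of n "[Node []]" "replicate l (Node [])" "2 * k"] Suc n
        by (simp add: replicate_append_same)
    qed simp
  qed simp
  then show ?thesis
    using assms by (auto elim: evenE)
qed

text \<open>The cost is at most \<open>m\<close> for a diameter, \<open>1\<close> for removing it,
  and \<open>3 * (2 * m - 2)\<close> from there, since at least two branches besides the separating
  leaf are present by then.\<close>

lemma reach_even_star:
  assumes M: "M \<in> nc_matchings (2 * m + 1)" and m: "m > 0"
  shows "(M, matching (2 * m + 1) 0 (replicate (2 * m + 1) (Node []))) \<in> flips m (7 * m - 5)"
proof -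
  let ?n = "2 * m + 1"
  obtain s F where F: "M = matching ?n s F" "nedges F = ?n" "\<forall>Z. Node Z \<in> set F \<longrightarrow> nedges Z \<le> m"
    using nc_matching_eq_centered_matching[OF M] .
  then obtain Z where Z: "Node Z \<in> set F"
    by (cases F rule: nedges.cases) auto
  obtain s1 A B where 1: "nedges A = m" "nedges B = m"
      "(M, matching ?n s1 (A @ [Node B])) \<in> flips m (m - nedges Z)"
    using reach_diameter[OF F(2) F(3)[rule_format] Z] unfolding F(1) by blast
  \<comment> \<open>An odd start is arranged by the choice of the side of the diameter;
    \<open>diameter_flip\<close> then moves it by \<open>4 * m + 1\<close> to an even one.\<close>
  have "\<exists>s2 A' B'. odd s2 \<and> nedges A' = m \<and> nedges B' = m \<and> matching ?n s1 (A @ [Node B]) = matching ?n s2 (A' @ [Node B'])"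
  proof (cases "odd s1")
    case True
    then show ?thesis using 1 by blast
  next
    case False
    then have "odd (s1 + 2 * m + 1)" by simp
    then show ?thesis using 1 diameter_switch[OF 1(1,2)] by blast
  qed
  then obtain s2 A' B' where 2: "odd s2" "nedges A' = m" "nedges B' = m"
      "matching ?n s1 (A @ [Node B]) = matching ?n s2 (A' @ [Node B'])"
    by blast
  have "A' \<noteq> []" using 2 m by auto
  then obtain A1 Y where A': "A' = A1 @ [Node Y]"
    by (rule last_branch)
  have 3: "(matching ?n s2 (A1 @ [Node Y, Node B']),
      matching ?n (s2 + 4 * m + 1) ((Node A1 # Y) @ Node [] # B')) \<in> flips m 1"
    using 2 A' by (intro diameter_flip) simp_all
  have "\<exists>s'. even s' \<and> (matching ?n (s2 + 4 * m + 1) ((Node A1 # Y) @ Node [] # B'),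
      matching ?n s' (replicate ?n (Node []))) \<in> flips m (3 * (2 * m - (length (Node A1 # Y) + length B')))"
    using 2 A' by (intro reach_star) simp_all
  then have 4: "(matching ?n (s2 + 4 * m + 1) ((Node A1 # Y) @ Node [] # B'),
      matching ?n 0 (replicate ?n (Node []))) \<in> flips m (3 * (2 * m - (length (Node A1 # Y) + length B')))"
    using matching_star_even by metis
  have "B' \<noteq> []" using 2 m by auto
  then have "length (Node A1 # Y) + length B' \<ge> 2"
    by (cases B') auto
  then have le: "m - nedges Z + 1 + 3 * (2 * m - (length (Node A1 # Y) + length B')) \<le> 7 * m - 5"
    using m by linarith
  have "(M, matching ?n s2 (A1 @ [Node Y, Node B'])) \<in> flips m (m - nedges Z)"
    using 1(3) 2(4) A' by simp
  from flips_mono[OF flips_trans[OF flips_trans[OF this 3] 4] le] show ?thesis .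
qed

section \<open>Distances in the flip graph\<close>

definition low :: "nat \<Rightarrow> complex set \<Rightarrow> nat" where
  "low n e = (LEAST k. pt n k \<in> e)"

definition even_low_count :: "nat \<Rightarrow> complex set set \<Rightarrow> nat" where
  "even_low_count n M = card {e \<in> M. even (low n e)}"

lemma low_eqI: "pt n a \<in> e \<Longrightarrow> (\<And>k. pt n k \<in> e \<Longrightarrow> a \<le> k) \<Longrightarrow> low n e = a"
  unfolding low_def by (rule Least_equality)

lemma finite_nc_matching:
  assumes "M \<in> nc_matchings n"
  shows "finite M"
proof (rule finite_subset)
  show "M \<subseteq> Pow (circle_points n)"
    using nc_matchings_edge(1)[OF assms] by blast
qed (simp add: circle_points_def)

text \<open>Before and after a flip, the lowest of the four points involved is the low point of its edge;
  hence only one of the two exchanged edges can change the count.\<close>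

lemma even_low_count_centered_flip:
  assumes M: "M \<in> nc_matchings n" and M': "M' \<in> nc_matchings n" and flip: "centered_flip M M'"
  shows "even_low_count n M \<le> even_low_count n M' + 1"
proof -
  obtain e f where ef: "e \<in> M" "f \<in> M" "e \<noteq> f"
    and M'_eq: "M' = (M - {e, f}) \<union> (quad_sides e f - {e, f})"
    using flip unfolding centered_flip_def spans_empty_quad_def by blast
  define M0 where "M0 = M - {e, f}"
  have "e \<noteq> {}"
    using nc_matchings_edge(2)[OF M ef(1)] by auto
  then obtain p where "p \<in> e" "p \<in> circle_points n"
    using nc_matchings_edge(1)[OF M ef(1)] by blast
  then have ex: "\<exists>k. pt n k \<in> e \<union> f"
    by (auto simp: circle_points_eq_pt)
  define a where "a = (LEAST k. pt n k \<in> e \<union> f)"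
  have a: "pt n a \<in> e \<union> f"
    unfolding a_def using ex by (rule LeastI_ex)
  have low: "low n g = a" if "g \<subseteq> e \<union> f" "pt n a \<in> g" for g
  proof (rule low_eqI[OF that(2)])
    show "a \<le> k" if "pt n k \<in> g" for k
      unfolding a_def using that \<open>g \<subseteq> e \<union> f\<close> by (intro Least_le) blast
  qed
  have "pt n a \<in> circle_points n"
    using a nc_matchings_edge(1)[OF M ef(1)] nc_matchings_edge(1)[OF M ef(2)] by blast
  \<comment> \<open>The edge of \<open>M'\<close> at the lowest vertex. It is not one of the
    unchanged edges, so it is a side of the quadrilateral and has low point
    \<open>a\<close>.\<close>
  then obtain g where g: "g \<in> M'" "pt n a \<in> g"
    using nc_matchings_cover[OF M'] by blast
  have disj: "pt n a \<notin> h" if "h \<in> M0" for h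
    using that a nc_matchings_unique[OF M _ ef(1)] nc_matchings_unique[OF M _ ef(2)]
    unfolding M0_def by blast
  then have gM0: "g \<notin> M0"
    using g(2) by blast
  then have "g \<subseteq> e \<union> f"
    using g(1) unfolding M'_eq M0_def quad_sides_def by blast
  then have lowg: "low n g = a"
    using g(2) by (rule low)
  obtain e1 f1 where ef1: "{e1, f1} = {e, f}" "pt n a \<in> e1"
    using a by (metis UnE insert_commute)
  have lowe: "low n e1 = a"
    using ef1 by (intro low) (auto simp: doubleton_eq_iff)
  have Meq: "M = M0 \<union> {e1, f1}"
    using ef unfolding ef1 M0_def by blast
  let ?E = "\<lambda>M. {e \<in> M. even (low n e)}"
  have fin: "finite (?E M0)" "finite (?E M')"
    using finite_nc_matching[OF M] finite_nc_matching[OF M'] by (simp_all add: M0_def)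
  \<comment> \<open>The contribution of the edge at \<open>a\<close>, the same before and after the
    flip; the extra \<open>1\<close> in the bound is for \<open>f1\<close>.\<close>
  define \<epsilon> :: nat where "\<epsilon> = (if even a then 1 else 0)"
  have "?E M \<subseteq> ?E M0 \<union> ((if even a then {e1} else {}) \<union> {f1})"
    unfolding Meq using lowe by auto
  then have "card (?E M) \<le> card (?E M0 \<union> ((if even a then {e1} else {}) \<union> {f1}))"
    using fin by (intro card_mono) auto
  also have "\<dots> \<le> card (?E M0) + card ((if even a then {e1} else {}) \<union> {f1})"
    by (rule card_Un_le)
  also have "\<dots> \<le> card (?E M0) + (\<epsilon> + 1)"
    unfolding \<epsilon>_def by (auto intro: order.trans[OF card_insert_le_m1])
  also have "card (?E M0) + \<epsilon> = card (?E M0 \<union> (if even a then {g} else {}))"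
    using gM0 fin by (auto simp: \<epsilon>_def)
  then have "card (?E M0) + (\<epsilon> + 1) = card (?E M0 \<union> (if even a then {g} else {})) + 1"
    by simp
  also have "card (?E M0 \<union> (if even a then {g} else {})) \<le> card (?E M')"
    using fin g(1) lowg unfolding M'_eq M0_def by (intro card_mono) auto
  finally show ?thesis
    unfolding even_low_count_def by simp
qed

lemma matching_star:
  "matching n s (replicate k (Node [])) = (\<lambda>i. {pt n (s + 2 * i), pt n (s + 2 * i + 1)}) ` {..<k}"
proof (induction k)
  case (Suc k)
  have "matching n s (replicate (Suc k) (Node [])) = matching n s (replicate k (Node []) @ [Node []])"
    by (simp add: replicate_append_same)
  also have "\<dots> = insert {pt n (s + 2 * k), pt n (s + 2 * k + 1)}
      ((\<lambda>i. {pt n (s + 2 * i), pt n (s + 2 * i + 1)}) ` {..<k})"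
    unfolding matching_append Suc matching_Cons by simp
  finally show ?case
    by (simp add: lessThan_Suc)
qed simp

lemma low_edge:
  assumes "i < j" "j < 2 * n"
  shows "low n {pt n i, pt n j} = i"
proof (rule low_eqI)
  fix k assume k: "pt n k \<in> {pt n i, pt n j}"
  show "i \<le> k"
  proof (rule ccontr)
    assume "\<not> i \<le> k"
    then show False
      using k pt_eq_iff[of n 0 k i] pt_eq_iff[of n 0 k j] assms by simp
  qed
qed simp

lemma even_low_count_even_star:
  "even_low_count n (matching n 0 (replicate n (Node []))) = n"
proof -
  let ?e = "\<lambda>i. {pt n (0 + 2 * i), pt n (0 + 2 * i + 1)}"
  have low: "low n (?e i) = 2 * i" if "i < n" for i
    using that low_edge[of "2 * i" "2 * i + 1" n] by simp
  then have "{e \<in> ?e ` {..<n}. even (low n e)} = ?e ` {..<n}"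
    by auto
  moreover have "inj_on ?e {..<n}"
  proof (rule inj_onI)
    fix i j assume "i \<in> {..<n}" "j \<in> {..<n}" "?e i = ?e j"
    then show "i = j"
      using low[of i] low[of j] by simp
  qed
  ultimately show ?thesis
    unfolding even_low_count_def matching_star by (simp add: card_image)
qed

text \<open>Every edge but the last runs from an odd index to the next even one. The last joins
  indices \<open>2 * n - 1\<close> and \<open>2 * n\<close>, so it wraps around and is the only one
  that can be counted.\<close>

lemma even_low_count_odd_star:
  "even_low_count n (matching n 1 (replicate n (Node []))) \<le> 1"
proof -
  let ?e = "\<lambda>i. {pt n (1 + 2 * i), pt n (1 + 2 * i + 1)}"
  have "low n (?e i) = 1 + 2 * i" if "i < n - 1" for i
    using that by (intro low_edge) auto
  then have "{e \<in> ?e ` {..<n}. even (low n e)} \<subseteq> {?e (n - 1)}"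
  proof (intro subsetI)
    fix e assume "e \<in> {e \<in> ?e ` {..<n}. even (low n e)}"
    then obtain i where i: "i < n" "e = ?e i" "even (low n (?e i))"
      by blast
    then have "\<not> i < n - 1"
      using \<open>\<And>i. i < n - 1 \<Longrightarrow> low n (?e i) = 1 + 2 * i\<close>[of i] by (metis even_Suc even_mult_iff even_numeral plus_1_eq_Suc)
    then have "i = n - 1" using i(1) by simp
    then show "e \<in> {?e (n - 1)}" using i(2) by simp
  qed
  then have "card {e \<in> ?e ` {..<n}. even (low n e)} \<le> card {?e (n - 1)}"
    by (rule card_mono[rotated]) simp
  then show ?thesis
    unfolding even_low_count_def matching_star by simp
qed

section \<open>Walks in the graph and the two bounds\<close>

lemma arcs_H_graph:
  "(M, M') \<in> arcs (H_graph n) \<longleftrightarrow> M \<in> nc_matchings n \<and> M' \<in> nc_matchings n \<and> centered_flip M M'"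
  by (simp add: H_graph_def)

lemma H_graph_simps [simp]:
  "verts (H_graph n) = nc_matchings n" "tail (H_graph n) = fst" "head (H_graph n) = snd"
  by (simp_all add: H_graph_def)

lemma awalk_even_low_count:
  assumes "pre_digraph.awalk (H_graph n) M p M'"
  shows "even_low_count n M \<le> even_low_count n M' + length p"
proof -
  interpret wf_digraph "H_graph n" by (rule wf_digraph_H_graph)
  show ?thesis
    using assms
  proof (induction p arbitrary: M)
    case Nil
    then show ?case by (simp add: awalk_Nil_iff)
  next
    case (Cons a p)
    obtain L N where a: "a = (L, N)" by (cases a)
    have "(L, N) \<in> arcs (H_graph n)" "M = L" "awalk N p M'"
      using Cons.prems by (simp_all add: awalk_Cons_iff a)
    then show ?case
      using Cons.IH[of N] even_low_count_centered_flip[of L n N] by (simp add: arcs_H_graph)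
  qed
qed

lemma (in wf_digraph) awalk_cost_one: "awalk_cost (\<lambda>_. 1) p = real (length p)"
  by (induction p) simp_all

text \<open>Trivial steps of the reflexive closure are dropped, so the walk may be shorter than
  \<open>k\<close>.\<close>

lemma flips_imp_awalk:
  assumes n: "n = 2 * m + 1" and "(M, M') \<in> flips m k" "M \<in> nc_matchings n"
  shows "\<exists>p. pre_digraph.awalk (H_graph n) M p M' \<and> length p \<le> k"
proof -
  interpret wf_digraph "H_graph n" by (rule wf_digraph_H_graph)
  show ?thesis
    using assms(2,3)
  proof (induction k arbitrary: M)
    case 0
    then show ?case
      by (intro exI[of _ "[]"]) (simp add: flips_def awalk_Nil_iff)
  next
    case (Suc k)
    then obtain L where L: "(M, L) \<in> (flip_rel m)\<^sup>=" "(L, M') \<in> flips m k"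
      unfolding flips_def by (meson relpow_Suc_D2)
    show ?case
    proof (cases "M = L")
      case True
      then show ?thesis
        using Suc.IH[OF L(2)] Suc.prems(2) by (auto intro: le_SucI)
    next
      case False
      then have flip: "(M, L) \<in> flip_rel m"
        using L(1) by simp
      then obtain p where p: "awalk L p M'" "length p \<le> k"
        using Suc.IH[OF L(2)] flip_rel_imp_centered_flip(2)[OF flip] n by blast
      have "(M, L) \<in> arcs (H_graph n)"
        using flip_rel_imp_centered_flip[OF flip] by (simp add: arcs_H_graph n)
      then have "awalk M ((M, L) # p) M'"
        using p by (simp add: awalk_Cons_iff)
      then show ?thesis
        using p(2) by (intro exI[of _ "(M, L) # p"]) simp
    qed
  qed
qed

theorem theorem8:
  fixes n :: nat
  assumes "odd n" and "n \<ge> 3"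
  shows "ereal (real n - 1) \<le> graph_diameter (H_graph n) \<and>
         graph_diameter (H_graph n) \<le> ereal (11 * real n - 29)"
proof
  interpret wf_digraph "H_graph n" by (rule wf_digraph_H_graph)
  let ?A = "matching n 0 (replicate n (Node []))" and ?B = "matching n 1 (replicate n (Node []))"
  have AB: "?A \<in> nc_matchings n" "?B \<in> nc_matchings n"
    using assms(2) by (auto intro: matching_in_nc_matchings)
  have "ereal (real n - 1) \<le> \<mu> (\<lambda>_. 1) ?A ?B"
    unfolding \<mu>_def
  proof (rule INF_greatest)
    fix p assume "p \<in> {p. awalk ?A p ?B}"
    \<comment> \<open>The count falls from \<open>n\<close> to at most \<open>1\<close> along the
      walk, by at most one per arc.\<close>
    then have "n \<le> 1 + length p"
      using awalk_even_low_count[of n ?A p ?B] even_low_count_even_star[of n]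
        even_low_count_odd_star[of n] by simp
    then show "ereal (real n - 1) \<le> ereal (awalk_cost (\<lambda>_. 1) p)"
      by (simp add: awalk_cost_one)
  qed
  also have "\<dots> \<le> graph_diameter (H_graph n)"
    unfolding graph_diameter_def H_graph_simps by (rule SUP_upper2[OF AB(1)]) (rule SUP_upper[OF AB(2)])
  finally show "ereal (real n - 1) \<le> graph_diameter (H_graph n)" .
  obtain m where n: "n = 2 * m + 1" and m: "m > 0"
    using assms by (auto elim!: oddE)
  show "graph_diameter (H_graph n) \<le> ereal (11 * real n - 29)"
    unfolding graph_diameter_def H_graph_simps
  proof (intro SUP_least)
    fix M N assume M: "M \<in> nc_matchings n" and N: "N \<in> nc_matchings n"
    then have MN: "M \<in> nc_matchings (2 * m + 1)" "N \<in> nc_matchings (2 * m + 1)"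
      by (simp_all add: n)
    have "(M, N) \<in> flips m (7 * m - 5 + (7 * m - 5))"
      using flips_trans[OF reach_even_star[OF MN(1) m] flips_sym[OF reach_even_star[OF MN(2) m]]] .
    then obtain p where p: "awalk M p N" "length p \<le> 7 * m - 5 + (7 * m - 5)"
      using flips_imp_awalk[OF n _ M] by blast
    have "\<mu> (\<lambda>_. 1) M N \<le> ereal (awalk_cost (\<lambda>_. 1) p)"
      using p(1) by (rule min_cost_le_walk_cost)
    \<comment> \<open>The bound \<open>14 * m - 10\<close> is at most
      \<open>22 * m - 18 = 11 * n - 29\<close> because \<open>m\<close> is at least
      \<open>1\<close>, with equality for \<open>m = 1\<close>.\<close>
    also have "\<dots> \<le> ereal (11 * real n - 29)"
      using p(2) m by (simp add: awalk_cost_one n)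
    finally show "\<mu> (\<lambda>_. 1) M N \<le> ereal (11 * real n - 29)" .
  qed
qed

end
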